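(* For each prime $p\ge 3$ let $$J_{0,p}(x) = \sum_{n=0}^{\frac{p + 1}{2}} \frac{(-1)^n \left(\frac{x}{2}\right)^{2n}}{(n!)^2}$$ be the truncation of the Bessel function $J_0(x)=\sum_{n=0}^\infty \frac{(-1)^n (x/2)^{2n}}{(n!)^2}$. Then $$N_p(J_{0,p}) \ll p^{\frac{8}{9}},$$ that is, there is an absolute constant $C>0$ such that $N_p(J_{0,p})\le C p^{8/9}$ for all primes $p\ge 3$.
   Context: For a prime $p\ge 3$ and a polynomial $F(x)$ with rational coefficients whose denominators are coprime to $p$, $N_p(F)$ denotes the number of solutions $x$ modulo $p$ of the congruence $F(x)\equiv 0 \bmod p$ (i.e. the number of roots in $\mathbb{F}_p$ of the reduction of $F$ modulo $p$). *)

theory Defs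
  imports
    Complex_Main
    "HOL-Computational_Algebra.Polynomial"
    "HOL-Computational_Algebra.Primes"
begin

definition p_integral :: "nat \<Rightarrow> rat \<Rightarrow> bool" where
  "p_integral p r \<longleftrightarrow> coprime (snd (quotient_of r)) (int p)"

text \<open>Congruence modulo \<open>p\<close> of \<open>p\<close>-integral rationals, i.e. in the localisation of the
  integers at \<open>p\<close>.\<close>

definition rat_cong :: "nat \<Rightarrow> rat \<Rightarrow> rat \<Rightarrow> bool" where
  "rat_cong p a b \<longleftrightarrow> (\<exists>c. p_integral p c \<and> a - b = of_nat p * c)"

text \<open>The solutions modulo \<open>p\<close> are counted by their representatives in \<open>{0..<p}\<close>. This is
  the intended count only for \<open>F\<close> with \<open>p\<close>-integral coefficients; then the choice of
  representatives is irrelevant, see \<open>rat_cong_poly_shift\<close> below.\<close>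

definition num_roots_mod :: "nat \<Rightarrow> rat poly \<Rightarrow> nat" where
  "num_roots_mod p F = card {x \<in> {0..<int p}. rat_cong p (poly F (of_int x)) 0}"

definition bessel_J0_trunc :: "nat \<Rightarrow> rat poly" where
  "bessel_J0_trunc p =
     (\<Sum>n = 0..(p + 1) div 2. smult ((- 1) ^ n / (fact n)\<^sup>2) ([:0, 1 / 2:] ^ (2 * n)))"


lemma p_integralI:
  assumes "r * of_int d = of_int a" "coprime d (int p)" "d \<noteq> 0"
  shows "p_integral p r"
proof -
  obtain m n where q: "quotient_of r = (m, n)"
    by (cases "quotient_of r")
  have n: "n > 0" and mn: "coprime m n" and r: "r = of_int m / of_int n"
    using quotient_of_denom_pos[OF q] quotient_of_coprime[OF q] quotient_of_div[OF q] by auto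
  have "(of_int (m * d) :: rat) = of_int (a * n)"
    using assms(1) n by (simp add: r field_simps)
  then have "m * d = a * n"
    by (simp only: of_int_eq_iff)
  then have "n dvd d"
    using mn by (metis coprime_commute coprime_dvd_mult_right_iff dvd_triv_right)
  then show ?thesis
    using assms(2) q unfolding p_integral_def by (auto intro: coprime_divisors[of n d "int p" "int p"])
qed

lemma p_integralE:
  assumes "p_integral p r"
  obtains a d where "r * of_int d = of_int a" "coprime d (int p)" "d \<noteq> 0"
proof -
  obtain m n where q: "quotient_of r = (m, n)"
    by (cases "quotient_of r")
  show ?thesis
    using that[of n m] assms quotient_of_denom_pos[OF q] quotient_of_div[OF q] q
    by (auto simp: p_integral_def)
qed

lemma p_integral_of_int [simp]: "p_integral p (of_int a)"
  by (rule p_integralI[of _ 1 a]) auto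

lemma p_integral_0 [simp]: "p_integral p 0"
  using p_integral_of_int[of p 0] by simp

lemma p_integral_add:
  assumes "p_integral p r" "p_integral p s"
  shows "p_integral p (r + s)"
proof -
  obtain a d where r: "r * of_int d = of_int a" "coprime d (int p)" "d \<noteq> 0"
    using assms(1) by (rule p_integralE)
  obtain b e where s: "s * of_int e = of_int b" "coprime e (int p)" "e \<noteq> 0"
    using assms(2) by (rule p_integralE)
  have "(r + s) * of_int (d * e) = (r * of_int d) * of_int e + (s * of_int e) * of_int d"
    by (simp add: algebra_simps)
  also have "\<dots> = of_int (a * e + b * d)"
    by (simp add: r(1) s(1))
  finally show ?thesis
    by (rule p_integralI) (use r s in auto)
qed

lemma p_integral_mult:
  assumes "p_integral p r" "p_integral p s"
  shows "p_integral p (r * s)"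
proof -
  obtain a d where r: "r * of_int d = of_int a" "coprime d (int p)" "d \<noteq> 0"
    using assms(1) by (rule p_integralE)
  obtain b e where s: "s * of_int e = of_int b" "coprime e (int p)" "e \<noteq> 0"
    using assms(2) by (rule p_integralE)
  have "(r * s) * of_int (d * e) = (r * of_int d) * (s * of_int e)"
    by (simp add: algebra_simps)
  also have "\<dots> = of_int (a * b)"
    by (simp add: r(1) s(1))
  finally show ?thesis
    by (rule p_integralI) (use r s in auto)
qed

lemma p_integral_sum: "(\<And>i. i \<in> A \<Longrightarrow> p_integral p (f i)) \<Longrightarrow> p_integral p (sum f A)"
  by (induction A rule: infinite_finite_induct) (auto intro: p_integral_add)

lemma rat_cong_0_iff:
  assumes "prime p" "p_integral p r"
  shows "rat_cong p r 0 \<longleftrightarrow> int p dvd fst (quotient_of r)"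
proof -
  obtain m n where q: "quotient_of r = (m, n)"
    by (cases "quotient_of r")
  have n: "n > 0" and r: "r = of_int m / of_int n" and np: "coprime n (int p)"
    using quotient_of_denom_pos[OF q] quotient_of_div[OF q] assms(2) q
    by (auto simp: p_integral_def)
  show ?thesis
  proof
    assume "rat_cong p r 0"
    then obtain c where c: "p_integral p c" "r = of_nat p * c"
      by (auto simp: rat_cong_def)
    obtain a d where d: "c * of_int d = of_int a" "coprime d (int p)" "d \<noteq> 0"
      using c(1) by (rule p_integralE)
    have "(of_int (m * d) :: rat) = (r * of_int n) * of_int d"
      using n by (simp add: r)
    also have "\<dots> = of_nat p * (c * of_int d) * of_int n"
      by (simp add: c(2))
    also have "\<dots> = of_int (int p * (a * n))"
      by (simp add: d(1))
    finally have "m * d = int p * (a * n)"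
      by (simp only: of_int_eq_iff)
    then have "int p dvd m"
      using d(2) by (metis coprime_commute coprime_dvd_mult_left_iff dvd_triv_left)
    then show "int p dvd fst (quotient_of r)"
      by (simp add: q)
  next
    assume "int p dvd fst (quotient_of r)"
    then obtain k where k: "m = int p * k"
      by (auto simp: q)
    have "p_integral p (of_int k / of_int n)"
      by (rule p_integralI[of _ n k]) (use n np in auto)
    then show "rat_cong p r 0"
      unfolding rat_cong_def by (intro exI[of _ "of_int k / of_int n"]) (auto simp: r k)
  qed
qed

lemma p_integral_poly_shift:
  assumes "\<And>i. p_integral p (coeff F i)"
  shows "p_integral p (poly F (of_int x)) \<and>
         (\<exists>c. p_integral p c \<and> poly F (of_int (x + int p * k)) - poly F (of_int x) = of_nat p * c)"
  using assms
proof (induction F)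
  case 0
  show ?case by (auto intro: exI[of _ 0])
next
  case (pCons a F)
  have a: "p_integral p a"
    using pCons.prems[of 0] by simp
  have "p_integral p (coeff F i)" for i
    using pCons.prems[of "Suc i"] by simp
  then obtain c where F: "p_integral p (poly F (of_int x))" and c: "p_integral p c"
    and eq: "poly F (of_int (x + int p * k)) = poly F (of_int x) + of_nat p * c"
    using pCons.IH by (auto simp: algebra_simps)
  define c' where "c' = of_int (x + int p * k) * c + of_int k * poly F (of_int x)"
  have "p_integral p c'"
    unfolding c'_def by (intro p_integral_add p_integral_mult p_integral_of_int F c)
  moreover have "poly (pCons a F) (of_int (x + int p * k)) - poly (pCons a F) (of_int x) = of_nat p * c'"
    unfolding poly_pCons eq c'_def by (simp add: algebra_simps)
  moreover have "p_integral p (poly (pCons a F) (of_int x))"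
    unfolding poly_pCons by (intro p_integral_add p_integral_mult p_integral_of_int F a)
  ultimately show ?case by blast
qed

lemma rat_cong_poly_shift:
  assumes "\<And>i. p_integral p (coeff F i)"
  shows "rat_cong p (poly F (of_int (x + int p * k))) (poly F (of_int x))"
  using p_integral_poly_shift[OF assms] unfolding rat_cong_def by blast

lemma p_integral_coeff_bessel_J0_trunc:
  assumes "prime p" "p \<ge> 3"
  shows "p_integral p (coeff (bessel_J0_trunc p) i)"
proof -
  have pow: "[:0, 1 / 2 :: rat:] ^ m = monom ((1 / 2) ^ m) m" for m
    by (simp add: monom_altdef flip: smult_power)
  have cop: "coprime (int k) (int p)" if "\<not> p dvd k" for k
    using prime_imp_coprime[OF assms(1) that] by (simp add: coprime_commute)
  have "p_integral p ((- 1) ^ n / (fact n)\<^sup>2 * (1 / 2) ^ (2 * n))" if "n \<le> (p + 1) div 2" for n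
  proof (rule p_integralI[where a = "(- 1) ^ n"])
    have "n < p" using that assms(2) by linarith
    then have "\<not> p dvd fact n"
      using assms(1) by (simp add: prime_dvd_fact_iff)
    moreover have "\<not> p dvd 2"
      using assms(2) by (auto dest: dvd_imp_le)
    ultimately show "coprime (int ((fact n)\<^sup>2 * 2 ^ (2 * n))) (int p)"
      by (intro cop) (use assms(1) in \<open>auto simp: prime_dvd_mult_iff dest: prime_dvd_power\<close>)
  qed (auto simp: field_simps)
  then show ?thesis
    unfolding bessel_J0_trunc_def coeff_sum
    by (intro p_integral_sum) (auto simp: pow smult_monom)
qed

end

theory Submission
  imports Defs "HOL-Computational_Algebra.Polynomial_Factorial" "HOL-Library.FuncSet"
begin

text \<open>The proof is Stepanov's method, and it gives the exponent \<open>3 / 4\<close>. Put \<open>N = (p + 1) / 2\<close>,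
\<open>t = (x / 2)\<^sup>2\<close> and \<open>\<theta> = t d/dt\<close>. Up to the unit \<open>(N!)\<^sup>2\<close> the truncated Bessel function becomes a
polynomial \<open>F(t)\<close> of degree \<open>N\<close> with integer coefficients and
\<open>\<theta>\<^sup>2 F = - t F + (-1)^N t^(N + 1)\<close>. Write \<open>H = \<theta> F\<close> and \<open>w = t^(N - 1)\<close>. Then \<open>\<theta>\<close> maps polynomials in
\<open>t\<close>, \<open>F\<close>, \<open>H\<close>, \<open>w\<close> to such polynomials, and at the points \<open>t = (x / 2)\<^sup>2\<close> that come from roots \<open>x\<close> one
has \<open>F = 0\<close> and, by Fermat, \<open>w = 1\<close>.

Consider \<open>\<phi> = \<Sum> c t^i F^j H^k w^l\<close> with \<open>i < 2 r\<^sup>2\<close>, \<open>j + k \<le> 2 r\<close>, \<open>l < 2 r + 2\<close>. At the points in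
question \<open>\<theta>^m \<phi>\<close> is a polynomial in \<open>t\<close> and \<open>H\<close> alone, of degree \<open>O(r\<^sup>2)\<close> in \<open>t\<close> and at most \<open>2 r\<close>
in \<open>H\<close>. So vanishing to order \<open>r\<^sup>2\<close> at all these points amounts to fewer linear conditions on the
coefficients \<open>c\<close> than there are coefficients, and a solution exists modulo \<open>p\<close> that is not trivial. As
\<open>\<phi>\<close> has degree \<open>O(r p)\<close>, there are \<open>O(p / r)\<close> points, provided that \<open>\<phi>\<close> is not zero modulo \<open>p\<close>. This
is \<open>stepanov_bound\<close>; the choice \<open>r \<approx> (p / 500)^(1/4)\<close> finishes the proof.

That \<open>\<phi>\<close> does not vanish is the main point. Looking at the lowest power of \<open>w\<close> in \<open>\<phi>\<close>, one needs
that a nonzero polynomial \<open>P(t, Y, Z)\<close> of small degree cannot satisfy \<open>P(t, F, H) = 0\<close> modulo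
\<open>t^(N - 1)\<close>; this is \<open>zero_estimate\<close>. Let \<open>W\<close> be the space over the rational functions in \<open>t\<close> that
is spanned by \<open>P\<close> and its images under the derivation \<open>Y \<mapsto> Z\<close>, \<open>Z \<mapsto> - t Y\<close>, \<open>t \<mapsto> t\<close>; all its elements of
small degree vanish to high order when \<open>(F, H)\<close> is substituted for \<open>(Y, Z)\<close>. The operator
\<open>(F Z - H Y) (F \<partial>\<^sub>Y + H \<partial>\<^sub>Z) = F\<^sup>2 Z \<partial>\<^sub>Y + F H (Z \<partial>\<^sub>Z - Y \<partial>\<^sub>Y) - H\<^sup>2 Y \<partial>\<^sub>Z\<close>,
which is, up to a scalar, the logarithm of the monodromy at \<open>0\<close>, commutes with the derivation up to high order in
\<open>t\<close>. It therefore preserves \<open>W\<close> to high order: the obstruction is a solution of a differential equation with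
nilpotent residue at \<open>0\<close> that vanishes at \<open>0\<close>, hence vanishes up to order \<open>p\<close>
(\<open>horizontal_raise_preserves\<close>). But \<open>F\<^sup>2\<close>, \<open>F H\<close>, \<open>H\<^sup>2\<close> satisfy no linear relation with
coefficients of small degree, because \<open>H / F\<close> solves a Riccati equation that has no algebraic
solution of small degree (\<open>bessel_quadratic_independent\<close>). Hence \<open>W\<close> is stable under each of the three
operators, which span \<open>sl\<^sub>2\<close>. A nonzero subspace that is stable under \<open>sl\<^sub>2\<close> contains a power \<open>Y^n\<close>, and its value
\<open>F^n\<close> does not vanish at \<open>0\<close>: a contradiction.

Since \<open>p\<close> is a variable, polynomials over the field with \<open>p\<close> elements are represented by integer
polynomials that are considered modulo \<open>p\<close>, and linear algebra over the field of rational
functions modulo \<open>p\<close> is done without denominators.\<close>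

section \<open>The Euler derivation and congruences of integer polynomials\<close>

definition theta :: "int poly \<Rightarrow> int poly" where
  "theta a = pCons 0 (pderiv a)"

lemma coeff_theta: "coeff (theta a) n = int n * coeff a n"
  by (cases n) (auto simp: theta_def coeff_pCons coeff_pderiv)

lemma theta_0 [simp]: "theta 0 = 0"
  by (rule poly_eqI) (simp add: coeff_theta)

lemma theta_add: "theta (a + b) = theta a + theta b"
  by (rule poly_eqI) (simp add: coeff_theta algebra_simps)

lemma theta_diff: "theta (a - b) = theta a - theta b"
  by (rule poly_eqI) (simp add: coeff_theta algebra_simps)

lemma theta_minus: "theta (- a) = - theta a"
  by (rule poly_eqI) (simp add: coeff_theta algebra_simps)

lemma theta_smult: "theta (smult c a) = smult c (theta a)"
  by (rule poly_eqI) (simp add: coeff_theta algebra_simps)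

lemma theta_sum: "theta (sum f S) = (\<Sum>x\<in>S. theta (f x))"
  by (induction S rule: infinite_finite_induct) (auto simp: theta_add)

lemma theta_mult: "theta (a * b) = theta a * b + a * theta b"
  by (simp add: theta_def pderiv_mult algebra_simps)

lemma theta_power: "theta (a ^ n) = of_nat n * a ^ (n - 1) * theta a"
proof (induction n)
  case 0
  then show ?case by (simp add: theta_def)
next
  case (Suc n)
  then show ?case
    by (cases n) (simp_all add: theta_mult algebra_simps)
qed

lemma theta_of_nat [simp]: "theta (of_nat n) = 0"
  by (simp add: theta_def of_nat_poly)

lemma theta_of_int [simp]: "theta (of_int n) = 0"
  by (simp add: theta_def of_int_poly)

lemma theta_numeral [simp]: "theta (numeral k) = 0"
  by (simp add: theta_def numeral_poly)

lemma theta_numeral_mult: "theta (numeral k * a) = numeral k * theta a"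
  by (simp add: theta_smult numeral_poly)

lemma theta_monom: "theta (monom c n) = monom (int n * c) n"
  by (rule poly_eqI) (auto simp: coeff_theta)

abbreviation tvar :: "int poly" where "tvar \<equiv> [:0, 1:]"

lemma theta_tvar [simp]: "theta tvar = tvar"
  by (simp add: theta_def pderiv_pCons)

lemma degree_theta: "degree (theta a) \<le> degree a"
  by (rule degree_le) (auto simp: coeff_theta coeff_eq_0)

lemma coeff_numeral_mult: "coeff (numeral k * a) n = numeral k * coeff (a :: int poly) n"
  by (simp add: numeral_poly)

lemma coeff_tvar_mult: "coeff (tvar * a) n = (if n = 0 then 0 else coeff a (n - 1))"
  by (simp add: coeff_pCons split: nat.split)

lemma degree_tvar_mult: "degree (tvar * a) \<le> Suc (degree a)"
  by (simp add: degree_pCons_le)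

locale prime_modulus =
  fixes p :: int
  assumes prime_p: "prime p"
begin

lemma p_gt_1: "p > 1"
  using prime_p prime_gt_1_int by blast

lemma p_dvd_mult_iff: "p dvd a * b \<longleftrightarrow> p dvd a \<or> p dvd b"
  using prime_p by (simp add: prime_dvd_mult_iff)

text \<open>This says that a polynomial is zero over the field with \<open>p\<close> elements; \<open>null_below L\<close> below says the
same modulo \<open>t^L\<close>.\<close>

abbreviation null_mod :: "int poly \<Rightarrow> bool" where
  "null_mod a \<equiv> [:p:] dvd a"

lemma null_mod_iff: "null_mod a \<longleftrightarrow> (\<forall>n. p dvd coeff a n)"
  by (rule const_poly_dvd_iff)

lemma null_mod_mult_iff: "null_mod (a * b) \<longleftrightarrow> null_mod a \<or> null_mod b"
proof -
  have "prime_elem [:p:]"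
    using prime_p by (intro lift_prime_elem_poly) auto
  then show ?thesis
    by (rule prime_elem_dvd_mult_iff)
qed

lemma null_mod_poly: "null_mod a \<Longrightarrow> p dvd poly a x"
  by (auto simp: dvd_def)

lemma null_mod_power_iff: "null_mod (a ^ n) \<longleftrightarrow> n > 0 \<and> null_mod a"
proof (induction n)
  case 0
  have "\<not> p dvd 1" using p_gt_1 by auto
  then have "\<not> null_mod 1"
    using null_mod_poly[of 1 0] by auto
  then show ?case by simp
qed (auto simp: null_mod_mult_iff)

lemma null_mod_theta: "null_mod a \<Longrightarrow> null_mod (theta a)"
  by (auto simp: null_mod_iff coeff_theta)

definition null_below :: "nat \<Rightarrow> int poly \<Rightarrow> bool" where
  "null_below L a \<longleftrightarrow> (\<forall>n<L. p dvd coeff a n)"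

lemma null_below_0 [simp]: "null_below L 0"
  by (simp add: null_below_def)

lemma null_below_add: "null_below L a \<Longrightarrow> null_below L b \<Longrightarrow> null_below L (a + b)"
  by (simp add: null_below_def)

lemma null_below_diff: "null_below L a \<Longrightarrow> null_below L b \<Longrightarrow> null_below L (a - b)"
  by (simp add: null_below_def)

lemma null_below_sum: "(\<And>x. x \<in> S \<Longrightarrow> null_below L (f x)) \<Longrightarrow> null_below L (sum f S)"
  by (induction S rule: infinite_finite_induct) (auto intro: null_below_add)

lemma null_below_mult: "null_below L a \<Longrightarrow> null_below L (b * a)"
  unfolding null_below_def coeff_mult by (auto intro!: dvd_sum dvd_mult)

lemma null_below_mult': "null_below L a \<Longrightarrow> null_below L (a * b)"
  using null_below_mult[of L a b] by (simp add: mult.commute)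

lemma null_below_theta: "null_below L a \<Longrightarrow> null_below L (theta a)"
  by (auto simp: null_below_def coeff_theta)

lemma null_mod_imp_null_below: "null_mod a \<Longrightarrow> null_below L a"
  by (simp add: null_mod_iff null_below_def)

lemma null_below_imp_null_mod: "null_below L a \<Longrightarrow> degree a < L \<Longrightarrow> null_mod a"
  unfolding null_mod_iff null_below_def by (metis coeff_eq_0 dvd_0_right le_less_trans linorder_not_less)

text \<open>Only the product of the two lowest coefficients contributes in degree \<open>i + j\<close>. This replaces the
multiplicativity of the order at \<open>0\<close>.\<close>

lemma coeff_mult_lowest:
  assumes "null_below i u" "null_below j v"
  shows "null_below (i + j) (u * v)" "p dvd coeff (u * v) (i + j) - coeff u i * coeff v j"
proof -
  have *: "p dvd coeff u k * coeff v (n - k)" if "k \<le> n" "n \<le> i + j" "\<not> (k = i \<and> n = i + j)" for k n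
  proof (cases "k < i")
    case True
    then show ?thesis using assms(1) by (auto simp: null_below_def)
  next
    case False
    then have "n - k < j" using that by auto
    then show ?thesis using assms(2) by (auto simp: null_below_def)
  qed
  show "null_below (i + j) (u * v)"
    unfolding null_below_def coeff_mult by (auto intro!: dvd_sum *)
  have "coeff (u * v) (i + j) = coeff u i * coeff v j + (\<Sum>k\<in>{..i+j}-{i}. coeff u k * coeff v (i + j - k))"
    unfolding coeff_mult by (subst sum.remove[of _ i]) auto
  moreover have "p dvd (\<Sum>k\<in>{..i+j}-{i}. coeff u k * coeff v (i + j - k))"
    by (intro dvd_sum *) auto
  ultimately show "p dvd coeff (u * v) (i + j) - coeff u i * coeff v j"
    by simp
qed

lemma ex_lowest_coeff:
  assumes "\<not> null_below L a"
  obtains c where "null_below c a" "\<not> p dvd coeff a c" "c < L"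
proof -
  define c where "c = (LEAST n. \<not> p dvd coeff a n)"
  obtain n where n: "n < L" "\<not> p dvd coeff a n" using assms by (auto simp: null_below_def)
  have "\<not> p dvd coeff a c" unfolding c_def by (rule LeastI[of _ n]) (rule n)
  moreover have "c \<le> n" unfolding c_def by (rule Least_le) (rule n)
  moreover have "null_below c a" unfolding null_below_def c_def using not_less_Least by blast
  ultimately show ?thesis using that n by auto
qed

lemma null_below_cancel_unit:
  assumes "\<not> p dvd coeff u 0" "null_below L (u * v)"
  shows "null_below L v"
proof (rule ccontr)
  assume "\<not> null_below L v"
  then obtain c where c: "null_below c v" "\<not> p dvd coeff v c" "c < L" by (rule ex_lowest_coeff)
  have "p dvd coeff (u * v) (0 + c) - coeff u 0 * coeff v c"
    by (rule coeff_mult_lowest(2)) (use c in \<open>auto simp: null_below_def\<close>)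
  moreover have "p dvd coeff (u * v) c" using assms(2) c by (auto simp: null_below_def)
  ultimately have "p dvd coeff u 0 * coeff v c"
    by (metis add_0 dvd_diff_right_iff dvd_diff_commute)
  then show False using assms c by (simp add: p_dvd_mult_iff)
qed

text \<open>The representative with coefficients in \<open>{0..<p}\<close> has the same degree as the polynomial modulo \<open>p\<close>.\<close>

lemma ex_reduced:
  obtains b where "null_mod (a - b)" "degree b \<le> degree a" "b \<noteq> 0 \<Longrightarrow> \<not> p dvd lead_coeff b"
proof -
  define b where "b = map_poly (\<lambda>x. x mod p) a"
  have cb: "coeff b n = coeff a n mod p" for n
    by (simp add: b_def coeff_map_poly)
  have "null_mod (a - b)"
    by (simp add: null_mod_iff cb mod_eq_dvd_iff[symmetric])
  moreover have "degree b \<le> degree a"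
    by (rule degree_le) (simp add: cb coeff_eq_0)
  moreover have "\<not> p dvd lead_coeff b" if "b \<noteq> 0"
  proof
    assume "p dvd lead_coeff b"
    moreover have "lead_coeff b mod p = lead_coeff b" by (simp add: cb)
    ultimately have "lead_coeff b = 0" by auto
    then show False using that by simp
  qed
  ultimately show ?thesis using that by blast
qed

section \<open>Linear algebra modulo p without denominators\<close>

text \<open>The difference of two vectors with entries in \<open>{0..<p}\<close> and the same values is the solution: there are
more vectors than tuples of values.\<close>

lemma pigeonhole_mod:
  fixes c :: "'e \<Rightarrow> 'u \<Rightarrow> int"
  assumes "finite U" "finite E" "card E < card U"
  obtains x where "\<exists>u\<in>U. \<not> p dvd x u" "\<And>e. e \<in> E \<Longrightarrow> p dvd (\<Sum>u\<in>U. c e u * x u)"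
proof -
  define Dom where "Dom = PiE U (\<lambda>_. {0..<p})"
  define Cod where "Cod = PiE E (\<lambda>_. {0..<p})"
  define f where "f x = (\<lambda>e\<in>E. (\<Sum>u\<in>U. c e u * x u) mod p)" for x
  have "f ` Dom \<subseteq> Cod"
    using p_gt_1 by (auto simp: f_def Cod_def)
  moreover have "finite Cod" using assms by (auto simp: Cod_def intro: finite_PiE)
  moreover have "card Cod < card Dom"
    using assms p_gt_1 by (simp add: Cod_def Dom_def card_PiE)
  ultimately have "\<not> inj_on f Dom"
    by (meson card_inj_on_le linorder_not_less)
  then obtain x y where xy: "x \<in> Dom" "y \<in> Dom" "f x = f y" "x \<noteq> y"
    by (auto simp: inj_on_def)
  then obtain u where u: "u \<in> U" "x u \<noteq> y u"
    unfolding Dom_def by (meson PiE_ext)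
  have "\<not> p dvd x u - y u"
  proof
    have "x u \<in> {0..<p}" "y u \<in> {0..<p}" using xy u by (auto simp: Dom_def)
    moreover assume "p dvd x u - y u"
    ultimately have "x u = y u"
      by (metis atLeastLessThan_iff mod_eq_dvd_iff mod_pos_pos_trivial)
    then show False using u by simp
  qed
  moreover have "p dvd (\<Sum>u\<in>U. c e u * (x u - y u))" if "e \<in> E" for e
  proof -
    have "(\<Sum>u\<in>U. c e u * x u) mod p = (\<Sum>u\<in>U. c e u * y u) mod p"
      using fun_cong[OF xy(3), of e] that by (simp add: f_def)
    then show ?thesis
      by (simp add: mod_eq_dvd_iff right_diff_distrib sum_subtractf)
  qed
  ultimately show ?thesis using u by (intro that[of "\<lambda>u. x u - y u"]) auto
qed

text \<open>Comparing coefficients reduces the claim to \<open>pigeonhole_mod\<close>. With solutions of degree at most \<open>K\<close>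
there are \<open>card U * (K + 1)\<close> unknowns and \<open>card E * (K + d + 1)\<close> equations, and \<open>K = card E * d\<close> is
large enough. The degree bound takes the place of Cramer's rule.\<close>

lemma poly_linear_system_mod:
  fixes c :: "'e \<Rightarrow> 'u \<Rightarrow> int poly"
  assumes "finite U" "finite E" "card E < card U"
    and deg: "\<And>e u. e \<in> E \<Longrightarrow> u \<in> U \<Longrightarrow> degree (c e u) \<le> d"
  obtains x where "\<exists>u\<in>U. \<not> null_mod (x u)" "\<And>e. e \<in> E \<Longrightarrow> null_mod (\<Sum>u\<in>U. c e u * x u)"
    "\<And>u. degree (x u) \<le> card E * d"
proof -
  define K where "K = card E * d"
  have "card (E \<times> {..K+d}) < card (U \<times> {..K})"
  proof -
    have "card (E \<times> {..K+d}) = card E * Suc K + K"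
      by (simp add: card_cartesian_product K_def algebra_simps)
    also have "\<dots> < Suc (card E) * Suc K" by simp
    also have "\<dots> \<le> card U * Suc K" using assms by (intro mult_right_mono) auto
    also have "\<dots> = card (U \<times> {..K})" by (simp add: card_cartesian_product)
    finally show ?thesis .
  qed
  moreover define cc where "cc v w = coeff (c (fst v) (fst w) * monom 1 (snd w)) (snd v)" for v w
  ultimately obtain y where y: "\<exists>v\<in>U \<times> {..K}. \<not> p dvd y v"
    "\<And>v. v \<in> E \<times> {..K+d} \<Longrightarrow> p dvd (\<Sum>w\<in>U \<times> {..K}. cc v w * y w)"
    using assms pigeonhole_mod[of "U \<times> {..K}" "E \<times> {..K+d}" cc] by blast
  define x where "x u = (\<Sum>k\<le>K. monom (y (u, k)) k)" for u
  have cx: "coeff (x u) k = (if k \<le> K then y (u, k) else 0)" for u k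
    by (simp add: x_def coeff_sum)
  have dx: "degree (x u) \<le> K" for u
    by (rule degree_le) (simp add: cx)
  have "\<exists>u\<in>U. \<not> null_mod (x u)"
    using y(1) by (force simp: null_mod_iff cx)
  moreover have "null_mod (\<Sum>u\<in>U. c e u * x u)" if e: "e \<in> E" for e
  proof -
    have eq: "(\<Sum>u\<in>U. c e u * x u) = (\<Sum>w\<in>U \<times> {..K}. smult (y w) (c e (fst w) * monom 1 (snd w)))"
      unfolding x_def sum_distrib_left sum.cartesian_product
      by (intro sum.cong) (auto simp: mult_smult_right[symmetric] smult_monom)
    have "p dvd coeff (\<Sum>u\<in>U. c e u * x u) n" for n
    proof (cases "n \<le> K + d")
      case True
      then show ?thesis
        using y(2)[of "(e, n)"] e unfolding eq coeff_sum by (simp add: cc_def mult.commute)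
    next
      case False
      have "degree (\<Sum>u\<in>U. c e u * x u) \<le> d + K"
      proof (rule degree_sum_le)
        show "finite U" by fact
        show "degree (c e u * x u) \<le> d + K" if "u \<in> U" for u
          using degree_mult_le[of "c e u" "x u"] deg[OF e that] dx[of u] by linarith
      qed
      then show ?thesis using False by (simp add: coeff_eq_0)
    qed
    then show ?thesis by (simp add: null_mod_iff)
  qed
  ultimately show ?thesis
    using that[of x] dx unfolding K_def by blast
qed

text \<open>Linear independence of \<open>v 0, \<dots>, v (m - 1)\<close>, restricted to the coordinates in \<open>S\<close>, over the field of
rational functions modulo \<open>p\<close>. Clearing denominators, polynomial coefficients are enough.\<close>

definition indep_mod :: "'i set \<Rightarrow> nat \<Rightarrow> (nat \<Rightarrow> 'i \<Rightarrow> int poly) \<Rightarrow> bool" where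
  "indep_mod S m v \<longleftrightarrow>
     (\<forall>x. (\<forall>i\<in>S. null_mod (\<Sum>l<m. x l * v l i)) \<longrightarrow> (\<forall>l<m. null_mod (x l)))"

lemma indep_mod_card_le:
  assumes "finite S" "indep_mod S m v"
  shows "m \<le> card S"
proof (rule ccontr)
  assume "\<not> m \<le> card S"
  then have card: "card S < card {..<m}" by simp
  define d where "d = Max (insert 0 ((\<lambda>(i, l). degree (v l i)) ` (S \<times> {..<m})))"
  have le: "degree (v l i) \<le> d" if "i \<in> S" "l \<in> {..<m}" for i l
    unfolding d_def using assms(1) that by (intro Max_ge) auto
  obtain x where x: "\<exists>l\<in>{..<m}. \<not> null_mod (x l)" "\<And>i. i \<in> S \<Longrightarrow> null_mod (\<Sum>l\<in>{..<m}. v l i * x l)"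
    by (rule poly_linear_system_mod[OF _ assms(1) card le]) auto
  have "\<forall>i\<in>S. null_mod (\<Sum>l<m. x l * v l i)"
    using x(2) by (simp add: mult.commute)
  then show False
    using assms(2) x(1) unfolding indep_mod_def by (metis lessThan_iff)
qed

text \<open>Row rank equals column rank. A minimal set \<open>S\<close> of coordinates on which the vectors stay independent
carries no nonzero covector that annihilates all of them, since a coordinate in the support of such
a covector could be dropped from \<open>S\<close>. So the columns are independent as well, and their number is \<open>m\<close>.\<close>

lemma indep_mod_minor:
  assumes "finite I" "indep_mod I m v"
  obtains S where "S \<subseteq> I" "indep_mod S m v" "card S = m"
    "\<And>xi. (\<And>l. l < m \<Longrightarrow> null_mod (\<Sum>i\<in>S. v l i * xi i)) \<Longrightarrow> \<forall>i\<in>S. null_mod (xi i)"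
proof -
  define good where "good S \<longleftrightarrow> S \<subseteq> I \<and> indep_mod S m v" for S
  have "\<exists>S. good S" using assms by (auto simp: good_def)
  then obtain S where S: "good S" and least: "\<And>T. good T \<Longrightarrow> card S \<le> card T"
    using ex_has_least_nat[of good _ card] by blast
  have fin: "finite S" using S assms by (auto simp: good_def intro: finite_subset)
  have sep: "\<forall>i\<in>S. null_mod (xi i)" if xi: "\<And>l. l < m \<Longrightarrow> null_mod (\<Sum>i\<in>S. v l i * xi i)" for xi
  proof (rule ccontr)
    assume "\<not> (\<forall>i\<in>S. null_mod (xi i))"
    then obtain c where c: "c \<in> S" "\<not> null_mod (xi c)" by blast
    have "indep_mod (S - {c}) m v"
      unfolding indep_mod_def
    proof (intro allI impI)
      fix x l assume x: "\<forall>i\<in>S - {c}. null_mod (\<Sum>l<m. x l * v l i)" and l: "l < m"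
      have "null_mod (\<Sum>l<m. x l * (\<Sum>i\<in>S. v l i * xi i))"
        by (intro dvd_sum dvd_mult xi) auto
      also have "(\<Sum>l<m. x l * (\<Sum>i\<in>S. v l i * xi i)) = (\<Sum>i\<in>S. xi i * (\<Sum>l<m. x l * v l i))"
        unfolding sum_distrib_left by (subst sum.swap) (simp add: algebra_simps)
      also have "\<dots> = xi c * (\<Sum>l<m. x l * v l c) + (\<Sum>i\<in>S-{c}. xi i * (\<Sum>l<m. x l * v l i))"
        using fin c by (subst sum.remove[of _ c]) auto
      finally have "null_mod (xi c * (\<Sum>l<m. x l * v l c))"
        using x by (subst (asm) dvd_add_left_iff) (auto intro!: dvd_sum intro: dvd_mult)
      then have "null_mod (\<Sum>l<m. x l * v l c)" using c by (simp add: null_mod_mult_iff)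
      with x have "\<forall>i\<in>S. null_mod (\<Sum>l<m. x l * v l i)" by auto
      then show "null_mod (x l)" using S l by (auto simp: good_def indep_mod_def)
    qed
    then have "good (S - {c})" using S by (auto simp: good_def)
    from least[OF this] show False using c fin by (meson card_Diff1_less linorder_not_less)
  qed
  have "card S = m"
  proof (rule antisym)
    show "m \<le> card S" using S fin by (auto simp: good_def intro: indep_mod_card_le)
    show "card S \<le> m"
    proof -
      obtain g where g: "bij_betw g {..<card S} S"
        using ex_bij_betw_nat_finite[OF fin] by (auto simp: atLeast0LessThan)
      have "indep_mod {..<m} (card S) (\<lambda>i l. v l (g i))"
        unfolding indep_mod_def
      proof (intro allI impI)
        fix x i assume x: "\<forall>l\<in>{..<m}. null_mod (\<Sum>i<card S. x i * v l (g i))" and i: "i < card S"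
        define xi where "xi s = x (the_inv_into {..<card S} g s)" for s
        have inj: "inj_on g {..<card S}" and im: "g ` {..<card S} = S" using g by (auto simp: bij_betw_def)
        have xg: "xi (g i) = x i" if "i < card S" for i
          using the_inv_into_f_f[OF inj, of i] that by (simp add: xi_def)
        have "(\<Sum>s\<in>S. v l s * xi s) = (\<Sum>i<card S. x i * v l (g i))" for l
          by (subst sum.reindex_bij_betw[OF g, symmetric]) (simp add: xg mult.commute)
        then have "\<forall>s\<in>S. null_mod (xi s)" using x by (intro sep) auto
        then show "null_mod (x i)" using xg[OF i] i im by (metis imageI lessThan_iff)
      qed
      then show ?thesis using indep_mod_card_le[of "{..<m}" "card S"] by auto
    qed
  qed
  then show ?thesis using that[of S] S sep by (auto simp: good_def)
qed

text \<open>The double annihilator of a span is the span, with control of all degrees: it is enough to test \<open>Q\<close>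
against annihilating covectors of small degree, and the linear combination found is of small degree
too. On a square minor \<open>S\<close> the combination is obtained by solving a linear system; at every further
coordinate \<open>c\<close> it holds because of an annihilating covector that is supported on \<open>insert c S\<close>.\<close>

lemma double_annihilator_mod:
  fixes v :: "nat \<Rightarrow> 'i \<Rightarrow> int poly"
  assumes fin: "finite I" and ind: "indep_mod I m v"
    and dv: "\<And>l i. l < m \<Longrightarrow> i \<in> I \<Longrightarrow> degree (v l i) \<le> d"
    and dQ: "\<And>i. i \<in> I \<Longrightarrow> degree (Q i) \<le> d'" and dd: "d \<le> d'"
    and ann: "\<And>xi. (\<And>i. degree (xi i) \<le> m * d) \<Longrightarrow>
        (\<And>l. l < m \<Longrightarrow> null_mod (\<Sum>i\<in>I. xi i * v l i)) \<Longrightarrow> null_mod (\<Sum>i\<in>I. xi i * Q i)"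
  obtains a b where "\<not> null_mod a" "degree a \<le> m * d'"
    "\<And>i. i \<in> I \<Longrightarrow> null_mod (a * Q i + (\<Sum>l<m. b l * v l i))"
proof -
  obtain S where S: "S \<subseteq> I" "indep_mod S m v" "card S = m"
    and sep: "\<And>xi. (\<And>l. l < m \<Longrightarrow> null_mod (\<Sum>i\<in>S. v l i * xi i)) \<Longrightarrow> \<forall>i\<in>S. null_mod (xi i)"
    using indep_mod_minor[OF fin ind] by blast
  have finS: "finite S" using S fin finite_subset by blast
  obtain x where x: "\<exists>l\<in>{..m}. \<not> null_mod (x l)"
      "\<And>i. i \<in> S \<Longrightarrow> null_mod (\<Sum>l\<in>{..m}. (if l = m then Q i else v l i) * x l)"
      "\<And>l. degree (x l) \<le> card S * d'"
  proof (rule poly_linear_system_mod[of "{..m}" S "\<lambda>i l. if l = m then Q i else v l i" d'])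
    fix e u assume "e \<in> S" "u \<in> {..m}"
    then show "degree (if u = m then Q e else v u e) \<le> d'"
      using dv[of u e] dQ[of e] dd S(1) by (cases "u = m") force+
  qed (use finS S(3) in auto)
  have split: "(\<Sum>l\<in>{..m}. (if l = m then Q i else v l i) * x l) = x m * Q i + (\<Sum>l<m. x l * v l i)" for i
    by (simp add: lessThan_Suc_atMost[symmetric] mult.commute)
  have rel: "null_mod (x m * Q i + (\<Sum>l<m. x l * v l i))" if "i \<in> S" for i
    using x(2)[OF that] by (simp add: split)
  have nz: "\<not> null_mod (x m)"
  proof
    assume xm: "null_mod (x m)"
    then have "null_mod (\<Sum>l<m. x l * v l i)" if "i \<in> S" for i
      using rel[OF that] by (metis dvd_add_right_iff dvd_mult2)
    then have "\<forall>l<m. null_mod (x l)" using S(2) unfolding indep_mod_def by blast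
    then show False using x(1) xm by (metis atMost_iff le_neq_implies_less)
  qed
  have "null_mod (x m * Q c + (\<Sum>l<m. x l * v l c))" if c: "c \<in> I" for c
  proof (cases "c \<in> S")
    case True
    then show ?thesis by (rule rel)
  next
    case False
    obtain xi where xi: "\<exists>i\<in>insert c S. \<not> null_mod (xi i)"
      "\<And>l. l \<in> {..<m} \<Longrightarrow> null_mod (\<Sum>i\<in>insert c S. v l i * xi i)"
      "\<And>i. degree (xi i) \<le> card {..<m} * d"
    proof (rule poly_linear_system_mod[of "insert c S" "{..<m}" "\<lambda>l i. v l i" d])
      show "card {..<m} < card (insert c S)" using False finS S(3) by simp
    qed (use finS c S(1) dv in auto)
    have xc: "\<not> null_mod (xi c)"
    proof
      assume xc: "null_mod (xi c)"
      have "null_mod (\<Sum>i\<in>S. v l i * xi i)" if "l < m" for l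
      proof -
        have "null_mod (v l c * xi c + (\<Sum>i\<in>S. v l i * xi i))"
          using xi(2)[of l] that finS False by simp
        then show ?thesis using xc by (metis dvd_add_right_iff dvd_mult)
      qed
      then have "\<forall>i\<in>S. null_mod (xi i)" by (rule sep)
      then show False using xi(1) xc by auto
    qed
    define et where "et i = (if i \<in> insert c S then xi i else 0)" for i
    have et: "(\<Sum>i\<in>I. et i * w i) = (\<Sum>i\<in>insert c S. w i * xi i)" for w
      using S(1) c fin by (intro sum.mono_neutral_cong_right) (auto simp: et_def mult.commute)
    have ann': "null_mod (\<Sum>i\<in>I. et i * Q i)"
    proof (rule ann)
      show "degree (et i) \<le> m * d" for i using xi(3)[of i] by (auto simp: et_def)
      show "null_mod (\<Sum>i\<in>I. et i * v l i)" if "l < m" for l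
        unfolding et using that by (intro xi(2)) auto
    qed
    have "null_mod (\<Sum>i\<in>I. et i * (x m * Q i + (\<Sum>l<m. x l * v l i)))"
    proof -
      have "(\<Sum>i\<in>I. et i * (x m * Q i + (\<Sum>l<m. x l * v l i))) =
            x m * (\<Sum>i\<in>I. et i * Q i) + (\<Sum>i\<in>I. \<Sum>l<m. x l * (et i * v l i))"
        by (simp add: algebra_simps sum.distrib sum_distrib_left)
      also have "(\<Sum>i\<in>I. \<Sum>l<m. x l * (et i * v l i)) = (\<Sum>l<m. x l * (\<Sum>i\<in>I. et i * v l i))"
        by (subst sum.swap) (simp add: sum_distrib_left)
      also have "null_mod (x m * (\<Sum>i\<in>I. et i * Q i) + (\<Sum>l<m. x l * (\<Sum>i\<in>I. et i * v l i)))"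
      proof (intro dvd_add dvd_sum)
        show "null_mod (x m * (\<Sum>i\<in>I. et i * Q i))" using ann' by (rule dvd_mult)
        show "null_mod (x l * (\<Sum>i\<in>I. et i * v l i))" if "l \<in> {..<m}" for l
          unfolding et using that by (intro dvd_mult xi(2)) auto
      qed
      finally show ?thesis .
    qed
    then have "null_mod (xi c * (x m * Q c + (\<Sum>l<m. x l * v l c)) +
                 (\<Sum>i\<in>S. xi i * (x m * Q i + (\<Sum>l<m. x l * v l i))))"
      unfolding et using finS False by (simp add: mult.commute)
    moreover have "null_mod (\<Sum>i\<in>S. xi i * (x m * Q i + (\<Sum>l<m. x l * v l i)))"
      by (intro dvd_sum dvd_mult rel)
    ultimately have "null_mod (xi c * (x m * Q c + (\<Sum>l<m. x l * v l c)))"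
      using dvd_add_left_iff by blast
    then show ?thesis using xc by (simp only: null_mod_mult_iff) simp
  qed
  then show ?thesis using that[of "x m" x] nz x(3)[of m] S(3) by simp
qed

section \<open>Bessel functions satisfy no quadratic relation of small degree\<close>

text \<open>The hypothesis says that \<open>u = - a / b\<close> is a rational solution of the Riccati equation
\<open>\<theta> u = - t - u\<^sup>2\<close>. This is impossible by the parity of degrees: \<open>a\<^sup>2\<close> has even degree, \<open>t b\<^sup>2\<close> has
odd degree, and the larger one exceeds the degree of the other terms.\<close>

lemma riccati_not_rational_mod:
  assumes "null_mod (a * theta b - b * theta a + a * a + tvar * (b * b))"
  shows "null_mod a \<and> null_mod b"
proof -
  obtain a' where a': "null_mod (a - a')" "degree a' \<le> degree a" "a' \<noteq> 0 \<Longrightarrow> \<not> p dvd lead_coeff a'"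
    using ex_reduced[of a] by blast
  obtain b' where b': "null_mod (b - b')" "degree b' \<le> degree b" "b' \<noteq> 0 \<Longrightarrow> \<not> p dvd lead_coeff b'"
    using ex_reduced[of b] by blast
  define u v where "u = a - a'" and "v = b - b'"
  have a: "a = a' + u" and b: "b = b' + v" and u: "null_mod u" and v: "null_mod v"
    using a' b' by (auto simp: u_def v_def)
  define X where "X = a' * theta b' - b' * theta a' + a' * a' + tvar * (b' * b')"
  have "a * theta b - b * theta a + a * a + tvar * (b * b) =
      X + (u * theta b + a' * theta v - (v * theta a + b' * theta u) + u * (a + a') + tvar * (v * (b + b')))"
    unfolding a b X_def theta_add by algebra
  moreover have "null_mod (u * theta b + a' * theta v - (v * theta a + b' * theta u) + u * (a + a') + tvar * (v * (b + b')))"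
    using u v by (intro dvd_add dvd_diff) (auto simp only: null_mod_mult_iff null_mod_theta)
  ultimately have X: "null_mod X"
    using assms dvd_add_left_iff by metis
  have "a' = 0 \<and> b' = 0"
  proof (rule ccontr)
    assume nz: "\<not> (a' = 0 \<and> b' = 0)"
    let ?da = "degree a'" and ?db = "degree b'"
    have d1: "degree (a' * theta b') \<le> ?da + ?db" "degree (b' * theta a') \<le> ?da + ?db"
      using degree_mult_le[of a' "theta b'"] degree_mult_le[of b' "theta a'"]
        degree_theta[of a'] degree_theta[of b'] by linarith+
    have d2: "degree (a' * a') \<le> ?da + ?da" "degree (b' * b') \<le> ?db + ?db"
      by (rule degree_mult_le)+
    show False
    proof (cases "b' \<noteq> 0 \<and> ?da \<le> ?db")
      case True
      have "coeff X (Suc (?db + ?db)) = coeff (b' * b') (?db + ?db)"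
        using d1 d2 True by (simp add: X_def coeff_tvar_mult coeff_eq_0 del: mult_pCons_left mult_pCons_right)
      also have "\<dots> = lead_coeff b' * lead_coeff b'"
        by (rule coeff_mult_degree_sum)
      finally show False
        using X b'(3) True by (metis p_dvd_mult_iff null_mod_iff)
    next
      case False
      then have a0: "a' \<noteq> 0" using nz by auto
      have "coeff X (?da + ?da) = coeff (a' * a') (?da + ?da)"
      proof (cases "b' = 0")
        case True
        then show ?thesis by (simp add: X_def)
      next
        case b0: False
        then have "?db < ?da" using False by auto
        then show ?thesis
          using d1 d2 by (simp add: X_def coeff_tvar_mult coeff_eq_0 del: mult_pCons_left mult_pCons_right)
      qed
      also have "\<dots> = lead_coeff a' * lead_coeff a'"
        by (rule coeff_mult_degree_sum)
      finally show False
        using X a'(3) a0 by (metis p_dvd_mult_iff null_mod_iff)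
    qed
  qed
  then show ?thesis using a' b' by auto
qed

end

text \<open>A polynomial solution \<open>F\<close> of Bessel's equation \<open>\<theta>\<^sup>2 F = - t F\<close> modulo \<open>t^L\<close> that does not vanish at
\<open>0\<close>. The error \<open>R\<close> is part of the data, since the truncated series satisfies an equation with an error that is
known exactly.\<close>

locale bessel_mod = prime_modulus +
  fixes F H R :: "int poly" and L :: nat
  assumes theta_F: "theta F = H"
    and theta_H: "theta H = R - tvar * F"
    and R_small: "null_below L R"
    and F_unit: "\<not> p dvd coeff F 0"
    and L_le: "int L \<le> p"
    and odd_p: "p \<noteq> 2"
begin

text \<open>A relation \<open>a F + b H = 0\<close> and its derivative are two linear equations for \<open>(F, H)\<close>. Their
determinant has small degree, so it vanishes exactly, which makes \<open>- a / b\<close> a rational solution of the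
Riccati equation.\<close>

lemma bessel_linear_independent:
  assumes "null_below L (a * F + b * H)" "2 * d + 1 < L" "degree a \<le> d" "degree b \<le> d"
  shows "null_mod a \<and> null_mod b"
proof -
  define a1 b1 where "a1 = theta a - tvar * b" and "b1 = theta b + a"
  have "theta (a * F + b * H) = a1 * F + b1 * H + b * R"
    unfolding theta_add theta_mult theta_F theta_H a1_def b1_def by algebra
  then have "a1 * F + b1 * H = theta (a * F + b * H) - b * R" by simp
  then have 1: "null_below L (a1 * F + b1 * H)"
    using assms(1) R_small by (simp add: null_below_diff null_below_theta null_below_mult)
  have "F * (a * theta b - b * theta a + a * a + tvar * (b * b)) = b1 * (a * F + b * H) - b * (a1 * F + b1 * H)"
    unfolding a1_def b1_def by algebra
  then have "null_below L (F * (a * theta b - b * theta a + a * a + tvar * (b * b)))"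
    using assms(1) 1 by (simp only: null_below_diff null_below_mult)
  then have "null_below L (a * theta b - b * theta a + a * a + tvar * (b * b))"
    by (rule null_below_cancel_unit[OF F_unit])
  moreover have "degree (a * theta b - b * theta a + a * a + tvar * (b * b)) \<le> 2 * d + 1"
  proof (intro degree_add_le degree_diff_le)
    show "degree (a * theta b) \<le> 2 * d + 1" "degree (b * theta a) \<le> 2 * d + 1" "degree (a * a) \<le> 2 * d + 1"
      using degree_mult_le[of a "theta b"] degree_mult_le[of b "theta a"] degree_mult_le[of a a]
        degree_theta[of a] degree_theta[of b] assms by linarith+
    show "degree (tvar * (b * b)) \<le> 2 * d + 1"
      using degree_tvar_mult[of "b * b"] degree_mult_le[of b b] assms by linarith
  qed
  ultimately have "null_mod (a * theta b - b * theta a + a * a + tvar * (b * b))"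
    using assms(2) by (intro null_below_imp_null_mod) auto
  then show ?thesis by (rule riccati_not_rational_mod)
qed

lemma null_mod_const_mult: "\<not> p dvd c \<Longrightarrow> null_mod (of_int c * a) \<longleftrightarrow> null_mod a"
  by (simp add: null_mod_iff of_int_poly p_dvd_mult_iff)

lemma not_dvd_2: "\<not> p dvd 2"
  using odd_p prime_p p_gt_1 zdvd_imp_le[of p 2] by fastforce

text \<open>The two hypotheses hold for \<open>\<Delta> = b\<^sup>2 - 4 a g\<close> when both roots of \<open>a + b u + g u\<^sup>2\<close> solve the
Riccati equation \<open>\<theta> u = - t - u\<^sup>2\<close>. Modulo \<open>t^p\<close> this equation has just one solution, even
among Laurent series, so the roots coincide. In terms of lowest exponents: with \<open>c\<close>, \<open>d\<close> the orders of \<open>g\<close>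
and \<open>\<Delta>\<close>, the first hypothesis gives \<open>(d - 2 c) g\<^sub>c = 2 b\<^sub>c\<close> and the second \<open>\<Delta>\<^sub>2\<^sub>c = - b\<^sub>c\<^sup>2\<close>, and together
they force \<open>d\<close> to exceed \<open>2 c\<close> by a positive multiple of \<open>p\<close>.\<close>

lemma riccati_discriminant_mod:
  assumes 1: "null_mod (g * theta \<Delta> - 2 * \<Delta> * theta g - 2 * b * \<Delta>)"
    and 2: "null_mod (\<Delta> - (2 * (g * theta b - b * theta g) - 4 * tvar * (g * g) - b * b))"
    and deg: "int (degree \<Delta>) < p" and g: "\<not> null_mod g"
  shows "null_mod \<Delta>"
proof (rule ccontr)
  assume "\<not> null_mod \<Delta>"
  then obtain d where d: "null_below d \<Delta>" "\<not> p dvd coeff \<Delta> d"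
    by (meson ex_lowest_coeff null_below_imp_null_mod lessI)
  from g obtain c where c: "null_below c g" "\<not> p dvd coeff g c"
    by (meson ex_lowest_coeff null_below_imp_null_mod lessI)
  note mm = coeff_mult_lowest
  have th: "null_below n (theta x)" if "null_below n x" for n x using that by (rule null_below_theta)
  have b: "null_below c b"
  proof (rule ccontr)
    assume "\<not> null_below c b"
    then obtain e where e: "null_below e b" "\<not> p dvd coeff b e" "e < c" by (rule ex_lowest_coeff)
    have "p dvd coeff (g * theta \<Delta>) (d + e)" "p dvd coeff (\<Delta> * theta g) (d + e)"
      using mm(1)[OF c(1) th[OF d(1)]] mm(1)[OF d(1) th[OF c(1)]] e(3) by (auto simp: null_below_def)
    moreover have "p dvd coeff (g * theta \<Delta> - 2 * \<Delta> * theta g - 2 * b * \<Delta>) (d + e)"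
      using 1 by (simp add: null_mod_iff)
    ultimately have "p dvd 2 * coeff (\<Delta> * b) (d + e)"
      by (auto simp: algebra_simps numeral_poly dvd_add_left_iff dvd_diff_left_iff)
    then have "p dvd coeff (\<Delta> * b) (d + e)" using not_dvd_2 by (simp add: p_dvd_mult_iff)
    then have "p dvd coeff \<Delta> d * coeff b e"
      using mm(2)[OF d(1) e(1)] by (metis dvd_diff_right_iff)
    then show False using d e by (simp add: p_dvd_mult_iff)
  qed
  have A: "p dvd (int d - 2 * int c) * coeff g c - 2 * coeff b c"
  proof -
    have "p dvd coeff (g * theta \<Delta>) (c + d) - coeff g c * (int d * coeff \<Delta> d)"
      using mm(2)[OF c(1) th[OF d(1)]] by (simp add: coeff_theta)
    moreover have "p dvd coeff (\<Delta> * theta g) (c + d) - coeff \<Delta> d * (int c * coeff g c)"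
      using mm(2)[OF d(1) th[OF c(1)]] by (simp add: coeff_theta add.commute)
    moreover have "p dvd coeff (b * \<Delta>) (c + d) - coeff b c * coeff \<Delta> d"
      using mm(2)[OF b d(1)] by simp
    moreover have "p dvd coeff (g * theta \<Delta>) (c + d) - 2 * coeff (\<Delta> * theta g) (c + d) - 2 * coeff (b * \<Delta>) (c + d)"
      using 1 unfolding null_mod_iff by (simp add: mult.assoc numeral_poly)
    ultimately have "p dvd coeff \<Delta> d * ((int d - 2 * int c) * coeff g c - 2 * coeff b c)"
      by (simp add: dvd_def) algebra
    then show ?thesis using d by (simp add: p_dvd_mult_iff)
  qed
  define Y where "Y = 2 * (g * theta b - b * theta g) - 4 * tvar * (g * g) - b * b"
  have Yz: "null_below (c + c) Y"
  proof -
    have "null_below (c + c) (g * theta b)" "null_below (c + c) (b * theta g)" "null_below (c + c) (g * g)" "null_below (c + c) (b * b)"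
      by (intro mm(1) th b c)+
    then show ?thesis unfolding Y_def by (simp only: null_below_diff null_below_mult)
  qed
  have Yc: "p dvd coeff Y (c + c) + coeff b c * coeff b c"
  proof -
    have "p dvd coeff (g * theta b) (c + c) - coeff g c * (int c * coeff b c)"
      using mm(2)[OF c(1) th[OF b]] by (simp add: coeff_theta)
    moreover have "p dvd coeff (b * theta g) (c + c) - coeff b c * (int c * coeff g c)"
      using mm(2)[OF b th[OF c(1)]] by (simp add: coeff_theta)
    moreover have "p dvd coeff (b * b) (c + c) - coeff b c * coeff b c"
      using mm(2)[OF b b] by simp
    moreover have "p dvd coeff (tvar * (g * g)) (c + c)"
      using mm(1)[OF c(1) c(1)] by (auto simp: coeff_tvar_mult null_below_def simp del: mult_pCons_left mult_pCons_right)
    moreover have "coeff Y (c + c) = 2 * (coeff (g * theta b) (c + c) - coeff (b * theta g) (c + c))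
       - 4 * coeff (tvar * (g * g)) (c + c) - coeff (b * b) (c + c)"
      by (simp only: Y_def mult.assoc coeff_diff coeff_numeral_mult)
    ultimately show ?thesis by (simp only: dvd_def) algebra
  qed
  have DY: "p dvd coeff \<Delta> n - coeff Y n" for n
    using 2 unfolding Y_def[symmetric] by (simp add: null_mod_iff)
  have "null_below (c + c) \<Delta>"
    using DY Yz by (metis dvd_diff_left_iff null_below_def)
  then have "\<not> d < c + c" using d unfolding null_below_def by blast
  then have cd: "2 * c \<le> d" by simp
  have bc: "p dvd coeff b c"
  proof (cases "d = 2 * c")
    case True
    then have "p dvd 2 * coeff b c" using A by simp
    then show ?thesis using not_dvd_2 by (simp add: p_dvd_mult_iff)
  next
    case False
    then have "p dvd coeff \<Delta> (c + c)" using d cd by (auto simp: null_below_def)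
    then have "p dvd coeff Y (c + c)" using DY[of "c + c"] dvd_diff_right_iff by blast
    then have "p dvd coeff b c * coeff b c" using Yc dvd_add_right_iff by blast
    then show ?thesis by (simp add: p_dvd_mult_iff)
  qed
  then have "p dvd (int d - 2 * int c)"
    using A c by (auto simp: p_dvd_mult_iff dvd_diff_left_iff)
  moreover have "d \<noteq> 2 * c"
  proof
    assume dc: "d = 2 * c"
    have "p dvd coeff Y (c + c)" using bc Yc by (simp add: dvd_add_left_iff)
    then have "p dvd coeff \<Delta> (c + c)" using DY[of "c + c"] dvd_diff_left_iff by blast
    then show False using d dc by (simp add: mult_2)
  qed
  ultimately have "p \<le> int d - 2 * int c" using cd by (intro zdvd_imp_le) auto
  moreover have "d \<le> degree \<Delta>" using d by (intro le_degree) auto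
  ultimately show False using deg by linarith
qed

text \<open>A quadratic relation and its derivative have the common root \<open>H / F\<close>. If they are not proportional,
eliminating \<open>H\<^sup>2\<close> gives a linear relation, which is excluded. If they are, both roots of the quadratic
solve the Riccati equation, so its discriminant is zero and \<open>H / F\<close> would be rational.\<close>

lemma bessel_quadratic_independent:
  assumes G: "null_below L (a * (F * F) + b * (F * H) + g * (H * H))"
    and deg: "degree a \<le> B" "degree b \<le> B" "degree g \<le> B" and B: "4 * B + 3 < L"
  shows "null_mod a \<and> null_mod b \<and> null_mod g"
proof -
  define a1 b1 g1 where "a1 = theta a - tvar * b" and "b1 = theta b + 2 * a - 2 * (tvar * g)"
    and "g1 = theta g + b"
  have "theta (a * (F * F) + b * (F * H) + g * (H * H)) =
      a1 * (F * F) + b1 * (F * H) + g1 * (H * H) + (b * F + 2 * g * H) * R"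
    unfolding theta_add theta_mult theta_F theta_H a1_def b1_def g1_def by algebra
  then have "a1 * (F * F) + b1 * (F * H) + g1 * (H * H) =
      theta (a * (F * F) + b * (F * H) + g * (H * H)) - (b * F + 2 * g * H) * R"
    by simp
  then have G1: "null_below L (a1 * (F * F) + b1 * (F * H) + g1 * (H * H))"
    using G R_small by (simp add: null_below_diff null_below_theta null_below_mult)
  define u v where "u = g1 * a - g * a1" and "v = g1 * b - g * b1"
  have "F * (u * F + v * H) = g1 * (a * (F * F) + b * (F * H) + g * (H * H)) -
      g * (a1 * (F * F) + b1 * (F * H) + g1 * (H * H))"
    unfolding u_def v_def by algebra
  then have "null_below L (F * (u * F + v * H))"
    using G G1 by (simp only: null_below_diff null_below_mult)
  then have uv: "null_below L (u * F + v * H)"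
    by (rule null_below_cancel_unit[OF F_unit])
  have deg1: "degree a1 \<le> B + 1" "degree b1 \<le> B + 1" "degree g1 \<le> B"
  proof -
    have "degree (theta a) \<le> B" "degree (theta b) \<le> B" "degree (theta g) \<le> B"
      using degree_theta deg order_trans by blast+
    moreover have "degree (tvar * b) \<le> B + 1" "degree (tvar * g) \<le> B + 1"
      using degree_tvar_mult[of b] degree_tvar_mult[of g] deg by linarith+
    moreover have "degree (2 * a) \<le> B" "degree (2 * (tvar * g)) \<le> B + 1"
      using calculation deg by (simp_all add: numeral_poly order_trans[OF degree_smult_le])
    ultimately show "degree a1 \<le> B + 1" "degree b1 \<le> B + 1" "degree g1 \<le> B"
      unfolding a1_def b1_def g1_def using deg
      by (auto intro!: degree_diff_le degree_add_le)
  qed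
  have "degree u \<le> 2 * B + 1" "degree v \<le> 2 * B + 1"
    using degree_mult_le[of g1 a] degree_mult_le[of g1 b] degree_mult_le[of g a1] degree_mult_le[of g b1] deg deg1
    unfolding u_def v_def by (intro degree_diff_le; linarith)+
  then have uz: "null_mod u" and vz: "null_mod v"
    using bessel_linear_independent[OF uv, of "2 * B + 1"] B by auto
  have "null_mod g"
  proof (rule ccontr)
    assume g: "\<not> null_mod g"
    define D where "D = b * b - 4 * (a * g)"
    have "g * theta D - 2 * D * theta g - 2 * b * D = 4 * g * u - 2 * b * v"
      unfolding D_def u_def v_def a1_def b1_def g1_def theta_diff theta_numeral_mult theta_mult
        theta_numeral by algebra
    then have 1: "null_mod (g * theta D - 2 * D * theta g - 2 * b * D)"
      using uz vz by (simp only: dvd_diff dvd_mult)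
    have "D - (2 * (g * theta b - b * theta g) - 4 * tvar * (g * g) - b * b) = 2 * v"
      unfolding D_def v_def b1_def g1_def by algebra
    then have 2: "null_mod (D - (2 * (g * theta b - b * theta g) - 4 * tvar * (g * g) - b * b))"
      using vz by (simp only: dvd_mult)
    have "degree D \<le> 2 * B"
    proof -
      have "degree (b * b) \<le> 2 * B" "degree (a * g) \<le> 2 * B"
        using degree_mult_le[of b b] degree_mult_le[of a g] deg by linarith+
      then show ?thesis
        unfolding D_def by (intro degree_diff_le) (auto simp: numeral_poly order_trans[OF degree_smult_le])
    qed
    then have "null_mod D" using 1 2 g B L_le by (intro riccati_discriminant_mod[OF 1 2]) auto
    then have "null_mod (b * theta (2 * g) - (2 * g) * theta b + b * b + tvar * ((2 * g) * (2 * g)))"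
    proof -
      have "b * theta (2 * g) - (2 * g) * theta b + b * b + tvar * ((2 * g) * (2 * g)) = 2 * v - D"
        unfolding D_def v_def b1_def g1_def theta_numeral_mult by algebra
      then show ?thesis using \<open>null_mod D\<close> vz by (simp only: dvd_diff dvd_mult)
    qed
    then have "null_mod (2 * g)" using riccati_not_rational_mod by blast
    then show False using g null_mod_const_mult[of 2 g] not_dvd_2 by simp
  qed
  moreover from this have "null_below L (a * (F * F) + b * (F * H) + g * (H * H) - g * (H * H))"
    by (rule null_below_diff[OF G null_below_mult'[OF null_mod_imp_null_below]])
  then have "null_below L (F * (a * F + b * H))" by (simp add: algebra_simps)
  then have "null_below L (a * F + b * H)" by (rule null_below_cancel_unit[OF F_unit])
  then have "null_mod a \<and> null_mod b" using deg B by (intro bessel_linear_independent[of a b B]) auto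
  ultimately show ?thesis by blast
qed

end

section \<open>Forms in two variables and the action of sl(2)\<close>

text \<open>The value at \<open>(j, k)\<close> is the coefficient of \<open>Y^j Z^k\<close>, a polynomial in \<open>t\<close>. Forms of degree at most
\<open>E\<close> are considered on the index set \<open>simplex E\<close> only; all operators preserve \<open>j + k\<close>, so the values
outside do not matter.\<close>

type_synonym form = "nat \<times> nat \<Rightarrow> int poly"

definition simplex :: "nat \<Rightarrow> (nat \<times> nat) set" where
  "simplex E = {x. fst x + snd x \<le> E}"

lemma finite_simplex [simp]: "finite (simplex E)"
  by (rule finite_subset[of _ "{..E} \<times> {..E}"]) (auto simp: simplex_def)

text \<open>The operators \<open>Z \<partial>\<^sub>Y\<close>, \<open>Y \<partial>\<^sub>Z\<close> and \<open>Z \<partial>\<^sub>Z - Y \<partial>\<^sub>Y\<close>, in terms of coefficients.\<close>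

definition raise :: "form \<Rightarrow> form" where
  "raise Q = (\<lambda>(j, k). if k = 0 then 0 else of_nat (Suc j) * Q (Suc j, k - 1))"

definition lower :: "form \<Rightarrow> form" where
  "lower Q = (\<lambda>(j, k). if j = 0 then 0 else of_nat (Suc k) * Q (j - 1, Suc k))"

definition weight :: "form \<Rightarrow> form" where
  "weight Q = (\<lambda>(j, k). (of_nat k - of_nat j) * Q (j, k))"

text \<open>The derivation with \<open>t \<mapsto> t\<close>, \<open>Y \<mapsto> Z\<close>, \<open>Z \<mapsto> - t Y\<close>: it becomes \<open>\<theta>\<close> when a solution of Bessel's equation
and its derivative are substituted for \<open>Y\<close> and \<open>Z\<close>.\<close>

definition bessel_op :: "form \<Rightarrow> form" where
  "bessel_op Q = (\<lambda>x. theta (Q x) + raise Q x - tvar * lower Q x)"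

definition raise_adj :: "form \<Rightarrow> form" where
  "raise_adj xi = (\<lambda>(j, k). of_nat j * xi (j - 1, Suc k))"

definition lower_adj :: "form \<Rightarrow> form" where
  "lower_adj xi = (\<lambda>(j, k). of_nat k * xi (Suc j, k - 1))"

definition bessel_op_adj :: "form \<Rightarrow> form" where
  "bessel_op_adj xi = (\<lambda>x. theta (xi x) - raise_adj xi x + tvar * lower_adj xi x)"

definition pairing :: "nat \<Rightarrow> form \<Rightarrow> form \<Rightarrow> int poly" where
  "pairing E xi Q = (\<Sum>x\<in>simplex E. xi x * Q x)"

lemma pairing_raise: "pairing E xi (raise Q) = pairing E (raise_adj xi) Q"
proof -
  have "pairing E xi (raise Q) = (\<Sum>x | x \<in> simplex E \<and> snd x \<noteq> 0. xi x * raise Q x)"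
    unfolding pairing_def by (rule sum.mono_neutral_right) (auto simp: raise_def split: if_splits)
  also have "\<dots> = (\<Sum>x | x \<in> simplex E \<and> fst x \<noteq> 0. raise_adj xi x * Q x)"
    by (rule sum.reindex_bij_witness[where i = "\<lambda>(j, k). (j - 1, Suc k)" and j = "\<lambda>(j, k). (Suc j, k - 1)"])
      (auto simp: raise_def raise_adj_def simplex_def)
  also have "\<dots> = pairing E (raise_adj xi) Q"
    unfolding pairing_def by (rule sum.mono_neutral_left) (auto simp: raise_adj_def)
  finally show ?thesis .
qed

lemma pairing_lower: "pairing E xi (lower Q) = pairing E (lower_adj xi) Q"
proof -
  have "pairing E xi (lower Q) = (\<Sum>x | x \<in> simplex E \<and> fst x \<noteq> 0. xi x * lower Q x)"
    unfolding pairing_def by (rule sum.mono_neutral_right) (auto simp: lower_def split: if_splits)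
  also have "\<dots> = (\<Sum>x | x \<in> simplex E \<and> snd x \<noteq> 0. lower_adj xi x * Q x)"
    by (rule sum.reindex_bij_witness[where i = "\<lambda>(j, k). (Suc j, k - 1)" and j = "\<lambda>(j, k). (j - 1, Suc k)"])
      (auto simp: lower_def lower_adj_def simplex_def)
  also have "\<dots> = pairing E (lower_adj xi) Q"
    unfolding pairing_def by (rule sum.mono_neutral_left) (auto simp: lower_adj_def)
  finally show ?thesis .
qed

lemma pairing_add: "pairing E xi (\<lambda>x. P x + Q x) = pairing E xi P + pairing E xi Q"
  by (simp add: pairing_def algebra_simps sum.distrib)

lemma pairing_diff: "pairing E xi (\<lambda>x. P x - Q x) = pairing E xi P - pairing E xi Q"
  by (simp add: pairing_def algebra_simps sum_subtractf)

lemma pairing_mult: "pairing E xi (\<lambda>x. c * Q x) = c * pairing E xi Q"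
  by (simp add: pairing_def sum_distrib_left mult_ac)

lemma pairing_sum: "pairing E xi (\<lambda>x. \<Sum>l\<in>A. Q l x) = (\<Sum>l\<in>A. pairing E xi (Q l))"
  unfolding pairing_def sum_distrib_left by (rule sum.swap)

lemma pairing_add_left: "pairing E (\<lambda>x. xi x + et x) Q = pairing E xi Q + pairing E et Q"
  by (simp add: pairing_def algebra_simps sum.distrib)

lemma pairing_diff_left: "pairing E (\<lambda>x. xi x - et x) Q = pairing E xi Q - pairing E et Q"
  by (simp add: pairing_def algebra_simps sum_subtractf)

lemma pairing_mult_left: "pairing E (\<lambda>x. c * xi x) Q = c * pairing E xi Q"
  by (simp add: pairing_def sum_distrib_left mult_ac)

lemma theta_pairing:
  "theta (pairing E xi Q) = pairing E (\<lambda>x. theta (xi x)) Q + pairing E xi (\<lambda>x. theta (Q x))"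
  by (simp add: pairing_def theta_sum theta_mult sum.distrib)

text \<open>The product rule for the pairing of covectors and forms; it shows that the annihilator of a stable
space of forms is stable under the adjoint operator.\<close>

lemma theta_pairing_bessel_op:
  "theta (pairing E xi Q) = pairing E (bessel_op_adj xi) Q + pairing E xi (bessel_op Q)"
  unfolding bessel_op_def bessel_op_adj_def theta_pairing
  by (simp add: pairing_add pairing_diff pairing_mult pairing_add_left pairing_diff_left
      pairing_mult_left pairing_raise pairing_lower del: mult_pCons_left)

lemmas op_defs = raise_def lower_def weight_def

lemma raise_lin: "raise (\<lambda>x. a * P x + b * Q x) = (\<lambda>x. a * raise P x + b * raise Q x)"
  and lower_lin: "lower (\<lambda>x. a * P x + b * Q x) = (\<lambda>x. a * lower P x + b * lower Q x)"
  and weight_lin: "weight (\<lambda>x. a * P x + b * Q x) = (\<lambda>x. a * weight P x + b * weight Q x)"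
  by (auto simp: op_defs fun_eq_iff algebra_simps)

lemma bessel_op_lin: "bessel_op (\<lambda>x. a * P x + b * Q x) =
    (\<lambda>x. theta a * P x + a * bessel_op P x + (theta b * Q x + b * bessel_op Q x))"
  unfolding bessel_op_def raise_lin lower_lin theta_add theta_mult
  by (rule ext) algebra

lemma theta_raise: "theta (raise Q x) = raise (\<lambda>x. theta (Q x)) x"
  and theta_lower: "theta (lower Q x) = lower (\<lambda>x. theta (Q x)) x"
  and theta_weight: "theta (weight Q x) = weight (\<lambda>x. theta (Q x)) x"
  by (auto simp: op_defs theta_mult theta_diff split: prod.splits simp del: of_nat_Suc)

lemma raise_lower: "raise (lower Q) x = lower (raise Q) x + weight Q x"
proof (cases x)
  case (Pair j k)
  then show ?thesis by (cases j; cases k) (simp_all add: op_defs algebra_simps)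
qed

lemma raise_weight: "raise (weight Q) x = weight (raise Q) x - 2 * raise Q x"
proof (cases x)
  case (Pair j k)
  then show ?thesis by (cases k) (simp_all add: op_defs algebra_simps)
qed

lemma lower_weight: "lower (weight Q) x = weight (lower Q) x + 2 * lower Q x"
proof (cases x)
  case (Pair j k)
  then show ?thesis by (cases j) (simp_all add: op_defs algebra_simps)
qed

text \<open>A linear combination of two terms twice, so that the linearity of the operators applies as a rewrite rule.\<close>

lemma bessel_op_alt: "bessel_op Q = (\<lambda>x. 1 * (1 * theta (Q x) + 1 * raise Q x) + (- tvar) * lower Q x)"
  unfolding bessel_op_def by (rule ext) algebra

lemma bessel_op_raise: "bessel_op (raise Q) x = raise (bessel_op Q) x + tvar * weight Q x"
  unfolding bessel_op_alt raise_lin theta_raise raise_lower by algebra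

lemma bessel_op_lower: "bessel_op (lower Q) x = lower (bessel_op Q) x + weight Q x"
  unfolding bessel_op_alt lower_lin theta_lower raise_lower by algebra

lemma bessel_op_weight: "bessel_op (weight Q) x = weight (bessel_op Q) x - 2 * raise Q x - 2 * (tvar * lower Q x)"
  unfolding bessel_op_alt weight_lin theta_weight raise_weight lower_weight by algebra

context bessel_mod
begin

section \<open>Stable spaces are preserved by the monodromy\<close>

text \<open>The operator \<open>(F Z - H Y) (F \<partial>\<^sub>Y + H \<partial>\<^sub>Z)\<close>. Both factors are constant for the derivation
\<open>bessel_op\<close> (the first is a Wronskian), and at \<open>t = 0\<close> the operator is a multiple of \<open>raise\<close>.\<close>

definition horizontal_raise :: "form \<Rightarrow> form" where
  "horizontal_raise Q = (\<lambda>x. F * F * raise Q x + F * H * weight Q x - H * H * lower Q x)"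

lemma horizontal_raise_lin: "horizontal_raise (\<lambda>x. a * P x + b * Q x) = (\<lambda>x. a * horizontal_raise P x + b * horizontal_raise Q x)"
  unfolding horizontal_raise_def raise_lin lower_lin weight_lin by (rule ext) algebra

text \<open>The operator commutes with the derivation up to the error of Bessel's equation.\<close>

lemma bessel_op_horizontal_raise: "bessel_op (horizontal_raise Q) x = horizontal_raise (bessel_op Q) x + R * (F * weight Q x - 2 * H * lower Q x)"
proof -
  have "horizontal_raise Q = (\<lambda>x. 1 * (F * F * raise Q x + F * H * weight Q x) + (- H * H) * lower Q x)"
    by (simp add: horizontal_raise_def)
  then have "bessel_op (horizontal_raise Q) x = theta (F * F) * raise Q x + F * F * bessel_op (raise Q) x
     + (theta (F * H) * weight Q x + F * H * bessel_op (weight Q) x)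
     + (theta (- H * H) * lower Q x + (- H * H) * bessel_op (lower Q) x)"
    using theta_of_int[of 1] by (simp only: bessel_op_lin) (simp add: bessel_op_lin)
  then show ?thesis
    unfolding bessel_op_raise bessel_op_lower bessel_op_weight horizontal_raise_def theta_mult theta_minus theta_F theta_H by algebra
qed

lemma coeff_H_0: "coeff H 0 = 0"
  using theta_F by (metis coeff_theta mult_zero_left of_nat_0)

lemma pairing_horizontal_raise: "pairing E xi (horizontal_raise Q) = pairing E xi (raise Q) * (F * F)
    + pairing E xi (weight Q) * (F * H) + (- pairing E xi (lower Q)) * (H * H)"
  unfolding horizontal_raise_def pairing_diff pairing_add pairing_mult by algebra

definition annihilator :: "nat \<Rightarrow> form set \<Rightarrow> form set" where
  "annihilator E G = {xi. \<forall>Q\<in>G. null_mod (pairing E xi Q)}"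

lemma pairing_commute: "pairing E xi Q = pairing E Q xi"
  by (simp add: pairing_def mult.commute)

text \<open>Let \<open>C\<close> be the annihilator of \<open>G\<close> and \<open>W\<close> that of \<open>C\<close>. The pairings
\<open>y = \<langle>xi, horizontal_raise Q\<rangle>\<close> with \<open>xi\<close> in \<open>C\<close> and \<open>Q\<close> in \<open>W\<close> are shown to vanish coefficient by coefficient.
In degree \<open>0\<close> only \<open>\<langle>xi, raise Q\<rangle>\<close> counts, and \<open>raise Q\<close> agrees there with \<open>bessel_op Q\<close>, which lies in \<open>W\<close>. In
degree \<open>n > 0\<close>, the equation for \<open>\<theta> y\<close> expresses \<open>n\<close> times the coefficient of \<open>y\<close> by the
coefficients for \<open>(bessel_op_adj xi, Q)\<close> and \<open>(xi, bessel_op Q)\<close>. At \<open>t = 0\<close> both operators act through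
the nilpotent \<open>raise\<close>, so after finitely many steps one member of the pair is divisible by \<open>t\<close>. Dividing by
\<open>t\<close> stays inside \<open>C\<close> or \<open>W\<close> and reduces the degree.\<close>

lemma horizontal_raise_preserves:
  assumes stable: "\<And>Q xi. Q \<in> G \<Longrightarrow> xi \<in> annihilator E G \<Longrightarrow> null_mod (pairing E xi (bessel_op Q))"
    and xi: "xi \<in> annihilator E G" and Q: "Q \<in> annihilator E (annihilator E G)"
  shows "null_below L (pairing E xi (horizontal_raise Q))"
proof -
  define C where "C = annihilator E G"
  define W where "W = annihilator E C"
  have WC: "null_mod (pairing E xi Q)" if "xi \<in> C" "Q \<in> W" for xi Q
    using that pairing_commute[of E xi Q] by (simp add: W_def annihilator_def)
  have C_I: "xi \<in> C" if "\<And>Q. Q \<in> G \<Longrightarrow> null_mod (pairing E xi Q)" for xi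
    using that by (simp add: C_def annihilator_def)
  have W_I: "Q \<in> W" if "\<And>xi. xi \<in> C \<Longrightarrow> null_mod (pairing E xi Q)" for Q
    using that pairing_commute[of E Q] by (simp add: W_def annihilator_def)
  have C_D: "bessel_op_adj xi \<in> C" if "xi \<in> C" for xi
  proof (rule C_I)
    fix Q assume Q: "Q \<in> G"
    have "pairing E (bessel_op_adj xi) Q = theta (pairing E xi Q) - pairing E xi (bessel_op Q)"
      by (simp add: theta_pairing_bessel_op)
    moreover have "null_mod (pairing E xi Q)" using that Q by (simp add: C_def annihilator_def)
    ultimately show "null_mod (pairing E (bessel_op_adj xi) Q)"
      using stable[OF Q] that by (simp add: C_def null_mod_theta)
  qed
  have W_D: "bessel_op Q \<in> W" if "Q \<in> W" for Q
  proof (rule W_I)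
    fix xi assume xi: "xi \<in> C"
    have "pairing E xi (bessel_op Q) = theta (pairing E xi Q) - pairing E (bessel_op_adj xi) Q"
      by (simp add: theta_pairing_bessel_op)
    then show "null_mod (pairing E xi (bessel_op Q))"
      using WC[OF xi that] WC[OF C_D[OF xi] that] by (simp add: null_mod_theta)
  qed
  have null_mod_tvar: "null_mod (tvar * a) \<longleftrightarrow> null_mod a" for a
  proof -
    have "\<not> null_mod tvar"
      using p_gt_1 null_mod_poly[of tvar 1] by auto
    then show ?thesis by (simp only: null_mod_mult_iff) simp
  qed
  \<comment> \<open>\<open>strip\<close> is division by \<open>t\<close> for forms with constant terms divisible by \<open>p\<close>.\<close>
  define strip :: "form \<Rightarrow> form" where "strip Q = (\<lambda>x. poly_shift 1 (Q x))" for Q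
  define cst :: "form \<Rightarrow> form" where "cst Q = (\<lambda>x. [:coeff (Q x) 0:])" for Q
  have split: "Q = (\<lambda>x. tvar * strip Q x + 1 * cst Q x)" for Q
    unfolding strip_def cst_def
    by (rule ext, rule poly_eqI) (simp add: coeff_pCons coeff_poly_shift split: nat.split)
  have null_mod_cst: "null_mod (cst Q x)" if "p dvd coeff (Q x) 0" for Q x
    using that by (simp add: cst_def)
  have strip_null_mod: "null_mod (pairing E xi (strip Q))"
    if "null_mod (pairing E xi Q)" "\<forall>x\<in>simplex E. p dvd coeff (Q x) 0" for xi Q
  proof -
    have "pairing E xi Q = tvar * pairing E xi (strip Q) + pairing E xi (cst Q)"
      by (subst split[of Q]) (simp only: pairing_add pairing_mult mult_1)
    moreover have "null_mod (pairing E xi (cst Q))"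
      unfolding pairing_def by (intro dvd_sum dvd_mult null_mod_cst) (use that in auto)
    ultimately show ?thesis
      using that(1) null_mod_tvar by (metis dvd_add_left_iff)
  qed
  have theta_y: "theta (pairing E xi (horizontal_raise Q)) = pairing E (bessel_op_adj xi) (horizontal_raise Q) + pairing E xi (horizontal_raise (bessel_op Q))
      + R * pairing E xi (\<lambda>x. F * weight Q x - 2 * H * lower Q x)" for xi Q
    unfolding theta_pairing_bessel_op bessel_op_horizontal_raise pairing_add pairing_mult by simp
  have main: "\<forall>xi\<in>C. \<forall>Q\<in>W. p dvd coeff (pairing E xi (horizontal_raise Q)) n" if "n < L" for n
    using that
  proof (induction n rule: less_induct)
    case (less n)
    show ?case
    proof (cases "n = 0")
      case True
      show ?thesis
      proof (intro ballI)
        fix xi Q assume xi: "xi \<in> C" and Q: "Q \<in> W"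
        have "p dvd coeff (pairing E xi (bessel_op Q)) 0"
          using WC[OF xi W_D[OF Q]] by (simp add: null_mod_iff)
        moreover have "pairing E xi (bessel_op Q) = pairing E xi (\<lambda>x. theta (Q x)) + pairing E xi (raise Q)
            - tvar * pairing E xi (lower Q)"
          unfolding bessel_op_def pairing_diff pairing_add pairing_mult ..
        moreover have "coeff (pairing E xi (\<lambda>x. theta (Q x))) 0 = 0"
          by (simp add: pairing_def coeff_sum coeff_mult coeff_theta)
        ultimately have "p dvd coeff (pairing E xi (raise Q)) 0"
          by simp
        then show "p dvd coeff (pairing E xi (horizontal_raise Q)) n"
          unfolding True pairing_horizontal_raise by (simp add: coeff_mult coeff_H_0)
      qed
    next
      case n0: False
      have drop_Q: "p dvd coeff (pairing E xi (horizontal_raise Q)) n"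
        if "xi \<in> C" "Q \<in> W" "\<forall>x\<in>simplex E. p dvd coeff (Q x) 0" for xi Q
      proof -
        have "strip Q \<in> W"
          using WC that by (intro W_I strip_null_mod) auto
        then have "p dvd coeff (pairing E xi (horizontal_raise (strip Q))) (n - 1)"
          using less.IH[of "n - 1"] less.prems n0 that by auto
        moreover have "pairing E xi (horizontal_raise Q) = tvar * pairing E xi (horizontal_raise (strip Q)) + pairing E xi (horizontal_raise (cst Q))"
          by (subst split[of Q], subst horizontal_raise_lin) (simp only: pairing_add pairing_mult mult_1)
        moreover have "null_mod (pairing E xi (horizontal_raise (cst Q)))"
        proof -
          have "null_mod (horizontal_raise (cst Q) x)" if x: "x \<in> simplex E" for x
          proof -
            have "null_mod (raise (cst Q) x)" "null_mod (weight (cst Q) x)" "null_mod (lower (cst Q) x)"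
              using x \<open>\<forall>x\<in>simplex E. p dvd coeff (Q x) 0\<close>
              by (auto simp: op_defs simplex_def split: prod.splits intro!: dvd_mult null_mod_cst)
            then show ?thesis unfolding horizontal_raise_def by (intro dvd_diff dvd_add dvd_mult)
          qed
          then show ?thesis unfolding pairing_def by (intro dvd_sum dvd_mult) auto
        qed
        ultimately show ?thesis
          using n0 by (simp add: coeff_tvar_mult null_mod_iff del: mult_pCons_left)
      qed
      have drop_xi: "p dvd coeff (pairing E xi (horizontal_raise Q)) n"
        if "xi \<in> C" "Q \<in> W" "\<forall>x\<in>simplex E. p dvd coeff (xi x) 0" for xi Q
      proof -
        have "null_mod (pairing E (strip xi) P)" if P: "P \<in> G" for P
          using strip_null_mod[of P xi] \<open>xi \<in> C\<close> P \<open>\<forall>x\<in>simplex E. p dvd coeff (xi x) 0\<close>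
            pairing_commute[of E P xi] pairing_commute[of E P "strip xi"]
          by (simp add: C_def annihilator_def)
        then have "strip xi \<in> C" by (rule C_I)
        then have "p dvd coeff (pairing E (strip xi) (horizontal_raise Q)) (n - 1)"
          using less.IH[of "n - 1"] less.prems n0 that by auto
        moreover have "pairing E xi (horizontal_raise Q) = tvar * pairing E (strip xi) (horizontal_raise Q) + pairing E (cst xi) (horizontal_raise Q)"
          by (subst split[of xi]) (simp only: pairing_add_left pairing_mult_left mult_1)
        moreover have "null_mod (pairing E (cst xi) (horizontal_raise Q))"
          unfolding pairing_def by (intro dvd_sum dvd_mult2 null_mod_cst) (use that in auto)
        ultimately show ?thesis
          using n0 by (simp add: coeff_tvar_mult null_mod_iff del: mult_pCons_left)
      qed
      \<comment> \<open>At \<open>t = 0\<close> the form \<open>Q\<close> lives in \<open>Z\<close>-degree at least \<open>r\<close> and \<open>xi\<close> in \<open>Z\<close>-degree at most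
        \<open>E - s\<close>. Each application of the operators increases \<open>r\<close> or \<open>s\<close>.\<close>
      have "p dvd coeff (pairing E xi (horizontal_raise Q)) n"
        if "2 * E + 2 \<le> r + s + m" "xi \<in> C" "Q \<in> W"
          "\<forall>x\<in>simplex E. snd x < r \<longrightarrow> p dvd coeff (Q x) 0"
          "\<forall>x\<in>simplex E. E < snd x + s \<longrightarrow> p dvd coeff (xi x) 0" for m r s xi Q
        using that
      proof (induction m arbitrary: r s xi Q)
        case 0
        then consider "E < r" | "E < s" by linarith
        then show ?case
        proof cases
          case 1
          then show ?thesis using 0 by (intro drop_Q) (auto simp: simplex_def)
        next
          case 2
          then show ?thesis using 0 by (intro drop_xi) (auto simp: simplex_def)
        qed
      next
        case (Suc m)
        have "p dvd coeff (pairing E xi (horizontal_raise (bessel_op Q))) n"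
        proof (rule Suc.IH[of "Suc r" s])
          show "\<forall>x\<in>simplex E. snd x < Suc r \<longrightarrow> p dvd coeff (bessel_op Q x) 0"
            using Suc.prems(4)
            by (auto simp: bessel_op_def coeff_theta raise_def simplex_def of_nat_poly)
        qed (use Suc.prems W_D in auto)
        moreover have "p dvd coeff (pairing E (bessel_op_adj xi) (horizontal_raise Q)) n"
        proof (rule Suc.IH[of r "Suc s"])
          show "\<forall>x\<in>simplex E. E < snd x + Suc s \<longrightarrow> p dvd coeff (bessel_op_adj xi x) 0"
          proof (intro ballI impI)
            fix x assume x: "x \<in> simplex E" "E < snd x + Suc s"
            obtain j k where jk: "x = (j, k)" by (cases x)
            have "p dvd int j * coeff (xi (j - 1, Suc k)) 0"
              using Suc.prems(5) x jk by (cases j) (auto simp: simplex_def)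
            then show "p dvd coeff (bessel_op_adj xi x) 0"
              by (simp add: bessel_op_adj_def coeff_theta raise_adj_def jk of_nat_poly)
          qed
        qed (use Suc.prems C_D in auto)
        moreover have "p dvd coeff (R * pairing E xi (\<lambda>x. F * weight Q x - 2 * H * lower Q x)) n"
          using null_below_mult'[OF R_small] less.prems by (auto simp: null_below_def)
        ultimately have "p dvd int n * coeff (pairing E xi (horizontal_raise Q)) n"
          unfolding coeff_theta[symmetric] theta_y by simp
        moreover have "\<not> p dvd int n"
          using n0 less.prems L_le by (auto dest: zdvd_imp_le)
        ultimately show ?case by (simp add: p_dvd_mult_iff)
      qed
      from this[of 0 0 "2 * E + 2"] show ?thesis by (auto simp: simplex_def)
    qed
  qed
  then show ?thesis
    using xi Q unfolding null_below_def C_def W_def by blast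
qed

end

section \<open>The zero estimate\<close>

lemma degree_of_nat_mult_le: "degree (of_nat n * a :: int poly) \<le> degree a"
  by (simp add: of_nat_poly degree_smult_le)

lemma degree_raise_le:
  assumes "\<And>x. x \<in> simplex E \<Longrightarrow> degree (Q x) \<le> d" "x \<in> simplex E"
  shows "degree (raise Q x) \<le> d"
  using assms(2)
  by (auto simp: raise_def simplex_def simp del: of_nat_Suc
      intro!: order_trans[OF degree_of_nat_mult_le] assms(1) split: prod.split)

lemma degree_lower_le:
  assumes "\<And>x. x \<in> simplex E \<Longrightarrow> degree (Q x) \<le> d" "x \<in> simplex E"
  shows "degree (lower Q x) \<le> d"
  using assms(2)
  by (auto simp: lower_def simplex_def simp del: of_nat_Suc
      intro!: order_trans[OF degree_of_nat_mult_le] assms(1) split: prod.split)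

lemma weight_alt: "weight Q x = of_int (int (snd x) - int (fst x)) * Q x"
  by (simp add: weight_def split: prod.split)

lemma degree_weight_le: "degree (weight Q x) \<le> degree (Q x)"
  by (simp add: weight_alt of_int_poly degree_smult_le del: of_int_diff)

lemma degree_bessel_op_le:
  assumes "\<And>x. x \<in> simplex E \<Longrightarrow> degree (Q x) \<le> d" "x \<in> simplex E"
  shows "degree (bessel_op Q x) \<le> Suc d"
proof -
  have "degree (theta (Q x)) \<le> d" "degree (raise Q x) \<le> d" "degree (tvar * lower Q x) \<le> Suc d"
    using assms(1)[OF assms(2)] degree_theta[of "Q x"] degree_tvar_mult[of "lower Q x"]
      degree_lower_le[of E Q d x, OF assms] degree_raise_le[of E Q d x, OF assms] by linarith+
  then show ?thesis
    unfolding bessel_op_def by (intro degree_diff_le degree_add_le) linarith+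
qed

lemma pairing_weight: "pairing E xi (weight Q) = pairing E (weight xi) Q"
  by (simp add: pairing_def weight_alt mult_ac)

lemma degree_pairing_le:
  assumes "\<And>x. x \<in> simplex E \<Longrightarrow> degree (xi x) \<le> d" "\<And>x. x \<in> simplex E \<Longrightarrow> degree (Q x) \<le> d'"
  shows "degree (pairing E xi Q) \<le> d + d'"
  unfolding pairing_def
proof (rule degree_sum_le)
  fix x assume "x \<in> simplex E"
  then show "degree (xi x * Q x) \<le> d + d'"
    using degree_mult_le[of "xi x" "Q x"] assms[of x] by linarith
qed simp

context bessel_mod
begin

text \<open>Substitution of \<open>(F, H)\<close> for \<open>(Y, Z)\<close>, as the pairing with the covector \<open>F^j H^k\<close>.\<close>

definition eval_form :: "nat \<Rightarrow> form \<Rightarrow> int poly" where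
  "eval_form E Q = pairing E (\<lambda>(j, k). F ^ j * H ^ k) Q"

text \<open>The covector \<open>F^j H^k\<close> is killed by the adjoint of the derivation, up to the error of Bessel's equation.\<close>

lemma eval_bessel_op:
  assumes "null_below L (eval_form E Q)"
  shows "null_below L (eval_form E (bessel_op Q))"
proof -
  have adj: "bessel_op_adj (\<lambda>(j, k). F ^ j * H ^ k) = (\<lambda>(j, k). R * (of_nat k * F ^ j * H ^ (k - 1)))"
  proof (rule ext)
    fix x :: "nat \<times> nat"
    obtain j k where x: "x = (j, k)" by (cases x)
    have 1: "of_nat j * F ^ (j - 1) * H * H ^ k = of_nat j * (F ^ (j - 1) * H ^ Suc k)"
      by simp
    show "bessel_op_adj (\<lambda>(j, k). F ^ j * H ^ k) x = (case x of (j, k) \<Rightarrow> R * (of_nat k * F ^ j * H ^ (k - 1)))"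
      unfolding x bessel_op_adj_def raise_adj_def lower_adj_def prod.case theta_mult theta_power theta_F theta_H
        1[symmetric] power_Suc by algebra
  qed
  have "eval_form E (bessel_op Q) = theta (eval_form E Q) - pairing E (\<lambda>x. R * (case x of (j, k) \<Rightarrow> of_nat k * F ^ j * H ^ (k - 1))) Q"
    using theta_pairing_bessel_op[of E "\<lambda>(j, k). F ^ j * H ^ k" Q]
    unfolding eval_form_def adj by (simp add: case_prod_unfold)
  then show ?thesis
    using assms R_small unfolding pairing_mult_left by (simp only: null_below_diff null_below_theta null_below_mult')
qed

lemma null_mod_pairing:
  assumes "\<And>x. x \<in> simplex E \<Longrightarrow> null_mod (Q x)"
  shows "null_mod (pairing E xi Q)"
  unfolding pairing_def by (intro dvd_sum dvd_mult assms)

text \<open>Let \<open>v l\<close> be the derivatives of \<open>P\<close>, let \<open>m\<close> be the length of the longest independent initial segment,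
\<open>C\<close> the annihilator of this segment and \<open>W\<close> its span, given as the annihilator of \<open>C\<close>. Pairing a
covector of small degree in \<open>C\<close> with \<open>horizontal_raise (v l)\<close> gives a quadratic relation of small
degree between \<open>F\<close> and \<open>H\<close>, so its coefficients vanish. Hence \<open>W\<close> is stable under \<open>lower\<close>
and \<open>weight\<close>. Applying \<open>lower\<close> as often as possible yields a nonzero element of \<open>W\<close> without \<open>Z\<close>; eigenvectors
of \<open>weight\<close> then isolate a single \<open>Y^n\<close>. A multiple \<open>a Y^n\<close> with \<open>a\<close> of small degree is a
combination of the \<open>v l\<close>, so \<open>a F^n\<close> vanishes modulo \<open>t^L\<close>, which is absurd as \<open>F\<close> is a unit at \<open>0\<close>.\<close>

theorem zero_estimate:
  assumes E: "int E < p"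
    and deg: "\<And>x. x \<in> simplex E \<Longrightarrow> degree (P x) \<le> A"
    and nz: "\<exists>x\<in>simplex E. \<not> null_mod (P x)"
    and q: "q = card (simplex E)" and size: "4 * (q * (A + q) + A + q) + 3 < L"
  shows "\<not> null_below L (eval_form E P)"
proof
  assume vanish: "null_below L (eval_form E P)"
  \<comment> \<open>A bound for the degrees of all covectors and coefficients produced by linear algebra.\<close>
  define X where "X = q * (A + q)"
  have size': "4 * (X + A + q) + 3 < L" using size by (simp only: X_def)
  define I where "I = simplex E"
  have fin: "finite I" by (simp add: I_def)
  define v where "v l = (bessel_op ^^ l) P" for l
  have v_Suc: "v (Suc l) = bessel_op (v l)" for l by (simp add: v_def)
  have dv: "degree (v l x) \<le> A + l" if "x \<in> I" for l x
    using that unfolding I_def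
  proof (induction l arbitrary: x)
    case 0
    then show ?case using deg by (simp add: v_def)
  next
    case (Suc l)
    then show ?case unfolding v_Suc using degree_bessel_op_le[of E "v l" "A + l" x] by simp
  qed
  have ev: "null_below L (eval_form E (v l))" for l
    by (induction l) (use vanish in \<open>auto simp: v_def intro: eval_bessel_op\<close>)
  define m where "m = (LEAST n. \<not> indep_mod I (Suc n) v)"
  have "\<not> indep_mod I (Suc q) v"
    using indep_mod_card_le[OF fin, of "Suc q" v] by (auto simp: q I_def)
  then have dep: "\<not> indep_mod I (Suc m) v" and mq: "m \<le> q"
    unfolding m_def by (rule LeastI, rule Least_le)
  have m0: "m \<noteq> 0"
  proof
    assume "m = 0"
    then have "\<not> indep_mod I 1 v" using dep by simp
    moreover have "indep_mod I 1 v"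
      using nz by (auto simp: indep_mod_def v_def I_def null_mod_mult_iff)
    ultimately show False by simp
  qed
  then have ind: "indep_mod I m v"
    using not_less_Least[of "m - 1" "\<lambda>n. \<not> indep_mod I (Suc n) v"] by (simp add: m_def[symmetric])
  define G where "G = v ` {..<m}"
  define C where "C = annihilator E G"
  define W where "W = annihilator E C"
  have C_iff: "xi \<in> C \<longleftrightarrow> (\<forall>l<m. null_mod (pairing E xi (v l)))" for xi
    by (auto simp: C_def G_def annihilator_def)
  have W_iff: "Q \<in> W \<longleftrightarrow> (\<forall>xi\<in>C. null_mod (pairing E xi Q))" for Q
    by (simp add: W_def annihilator_def pairing_commute[of E Q])
  have vW: "v l \<in> W" if "l < m" for l
    using that by (auto simp: W_iff C_iff)
  have stable: "null_mod (pairing E xi (bessel_op Q))" if "Q \<in> G" "xi \<in> C" for Q xi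
  proof -
    obtain l where l: "Q = v l" "l < m" using \<open>Q \<in> G\<close> by (auto simp: G_def)
    show ?thesis
    proof (cases "Suc l = m")
      case False
      then show ?thesis using l \<open>xi \<in> C\<close> by (simp add: C_iff flip: v_Suc)
    next
      case True
      from dep obtain x i where x: "\<forall>y\<in>I. null_mod (\<Sum>l<Suc m. x l * v l y)" "i < Suc m" "\<not> null_mod (x i)"
        by (auto simp: indep_mod_def)
      have xm: "\<not> null_mod (x m)"
      proof
        assume xm: "null_mod (x m)"
        have "null_mod (\<Sum>l<m. x l * v l y)" if "y \<in> I" for y
        proof -
          have "null_mod ((\<Sum>l<m. x l * v l y) + x m * v m y)" using x(1) that by simp
          then show ?thesis using xm by (metis dvd_add_left_iff dvd_mult2)
        qed
        then have "\<forall>l<m. null_mod (x l)" using ind unfolding indep_mod_def by blast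
        then show False using x xm by (metis less_antisym)
      qed
      have "null_mod (pairing E xi (\<lambda>y. \<Sum>l<Suc m. x l * v l y))"
        by (rule null_mod_pairing) (use x(1) in \<open>auto simp: I_def\<close>)
      then have "null_mod ((\<Sum>l<m. x l * pairing E xi (v l)) + x m * pairing E xi (v m))"
        unfolding pairing_sum pairing_mult by simp
      moreover have "null_mod (\<Sum>l<m. x l * pairing E xi (v l))"
        using \<open>xi \<in> C\<close> by (intro dvd_sum dvd_mult) (auto simp: C_iff)
      ultimately have "null_mod (x m * pairing E xi (v m))" using dvd_add_right_iff by blast
      then show ?thesis using xm l True by (simp add: null_mod_mult_iff flip: v_Suc)
    qed
  qed
  define d where "d = A + q"
  have dv': "degree (v l x) \<le> d" if "l < m" "x \<in> I" for l x
    using dv[OF that(2), of l] that(1) mq by (simp add: d_def)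
  have certificate: "\<exists>a b. \<not> null_mod a \<and> degree a \<le> m * d' \<and> (\<forall>x\<in>I. null_mod (a * Q x + (\<Sum>l<m. b l * v l x)))"
    if low: "\<And>xi. xi \<in> C \<Longrightarrow> (\<And>x. degree (xi x) \<le> m * d) \<Longrightarrow> null_mod (pairing E xi Q)"
      and dQ: "\<And>x. x \<in> I \<Longrightarrow> degree (Q x) \<le> d'" and dd: "d \<le> d'" for Q d'
  proof (rule double_annihilator_mod[OF fin ind dv' dQ dd])
    show "null_mod (\<Sum>i\<in>I. xi i * Q i)"
      if "\<And>i. degree (xi i) \<le> m * d" "\<And>l. l < m \<Longrightarrow> null_mod (\<Sum>i\<in>I. xi i * v l i)" for xi
      using low[of xi] that by (simp add: C_iff pairing_def I_def)
  qed blast+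
  have certificate': "\<exists>a b. \<not> null_mod a \<and> (\<forall>x\<in>I. null_mod (a * Q x + (\<Sum>l<m. b l * v l x)))"
    if "\<And>xi. xi \<in> C \<Longrightarrow> (\<And>x. degree (xi x) \<le> m * d) \<Longrightarrow> null_mod (pairing E xi Q)" for Q
  proof -
    define d' where "d' = d + Max ((\<lambda>x. degree (Q x)) ` I)"
    have "degree (Q x) \<le> d'" if "x \<in> I" for x
      unfolding d'_def using fin that by (intro trans_le_add2 Max_ge) auto
    then show ?thesis using certificate[of Q d'] that by (auto simp: d'_def)
  qed
  have low_W: "Q \<in> W" if low: "\<And>xi. xi \<in> C \<Longrightarrow> (\<And>x. degree (xi x) \<le> m * d) \<Longrightarrow> null_mod (pairing E xi Q)" for Q
    unfolding W_iff
  proof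
    fix xi assume xi: "xi \<in> C"
    obtain a b where ab: "\<not> null_mod a" "\<forall>x\<in>I. null_mod (a * Q x + (\<Sum>l<m. b l * v l x))"
      using certificate'[OF low] by blast
    have "null_mod (pairing E xi (\<lambda>x. a * Q x + (\<Sum>l<m. b l * v l x)))"
      by (rule null_mod_pairing) (use ab in \<open>auto simp: I_def\<close>)
    then have "null_mod (a * pairing E xi Q + (\<Sum>l<m. b l * pairing E xi (v l)))"
      unfolding pairing_add pairing_sum pairing_mult .
    moreover have "null_mod (\<Sum>l<m. b l * pairing E xi (v l))"
      using xi by (intro dvd_sum dvd_mult) (auto simp: C_iff)
    ultimately have "null_mod (a * pairing E xi Q)" using dvd_add_left_iff by blast
    then show "null_mod (pairing E xi Q)" using ab by (simp add: null_mod_mult_iff)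
  qed
  have closed: "T Q \<in> W"
    if adj: "\<And>xi Q. pairing E xi (T Q) = pairing E (T' xi) Q"
      and T: "\<And>xi l. xi \<in> C \<Longrightarrow> (\<And>x. degree (xi x) \<le> m * d) \<Longrightarrow> l < m \<Longrightarrow> null_mod (pairing E xi (T (v l)))"
      and Q: "Q \<in> W" for T T' :: "form \<Rightarrow> form" and Q
  proof (rule low_W)
    fix xi assume xi: "xi \<in> C" "\<And>x. degree (xi x) \<le> m * d"
    obtain a b where ab: "\<not> null_mod a" "\<forall>x\<in>I. null_mod (a * Q x + (\<Sum>l<m. b l * v l x))"
      using certificate'[of Q] Q by (auto simp: W_iff)
    have "null_mod (pairing E (T' xi) (\<lambda>x. a * Q x + (\<Sum>l<m. b l * v l x)))"
      by (rule null_mod_pairing) (use ab in \<open>auto simp: I_def\<close>)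
    then have "null_mod (a * pairing E xi (T Q) + (\<Sum>l<m. b l * pairing E xi (T (v l))))"
      unfolding pairing_add pairing_sum pairing_mult adj .
    moreover have "null_mod (\<Sum>l<m. b l * pairing E xi (T (v l)))"
      using xi by (intro dvd_sum dvd_mult T) auto
    ultimately have "null_mod (a * pairing E xi (T Q))" using dvd_add_left_iff by blast
    then show "null_mod (pairing E xi (T Q))" using ab by (simp add: null_mod_mult_iff)
  qed
  have key: "null_mod (pairing E xi (weight (v l))) \<and> null_mod (pairing E xi (lower (v l)))"
    if xi: "xi \<in> C" "\<And>x. degree (xi x) \<le> m * d" and l: "l < m" for xi l
  proof -
    have "null_below L (pairing E xi (horizontal_raise (v l)))"
      using horizontal_raise_preserves[of G E xi "v l"] stable xi vW[OF l] by (simp add: C_def W_def)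
    moreover define B where "B = m * d + d"
    have "degree (pairing E xi (raise (v l))) \<le> B" "degree (pairing E xi (weight (v l))) \<le> B"
      "degree (pairing E xi (lower (v l))) \<le> B"
      unfolding B_def using xi(2) dv'[OF l] order_trans[OF degree_weight_le]
        degree_raise_le[of E "v l" d] degree_lower_le[of E "v l" d]
      by (auto intro!: degree_pairing_le simp: I_def)
    moreover have "4 * B + 3 < L"
    proof -
      have "m * d \<le> X" using mq by (simp add: X_def d_def)
      then show ?thesis using size' by (simp add: B_def d_def)
    qed
    ultimately show ?thesis
      unfolding pairing_horizontal_raise using bessel_quadratic_independent[of _ _ _ B] by fastforce
  qed
  have lower_W: "lower Q \<in> W" if "Q \<in> W" for Q
    using closed[of lower lower_adj Q] key that by (simp add: pairing_lower)
  have weight_W: "weight Q \<in> W" if "Q \<in> W" for Q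
    using closed[of weight weight Q] key that by (simp add: pairing_weight)
  have small: "\<not> p dvd n" if "n \<noteq> 0" "\<bar>n\<bar> \<le> int E" for n
    using that E zdvd_imp_le[of p "\<bar>n\<bar>"] by auto
  define supp where "supp Q = {x \<in> I. \<not> null_mod (Q x)}" for Q :: form
  \<comment> \<open>Nonzero elements of \<open>W\<close> of \<open>Z\<close>-degree at most \<open>n\<close> modulo \<open>p\<close>.\<close>
  define flat where "flat n Q \<longleftrightarrow> Q \<in> W \<and> supp Q \<noteq> {} \<and> (\<forall>x\<in>supp Q. snd x \<le> n)" for n Q
  have "\<exists>Q. flat 0 Q"
  proof -
    have "flat E P"
      using vW[of 0] m0 nz by (auto simp: flat_def supp_def I_def v_def simplex_def)
    then obtain n where n_ex: "\<exists>Q. flat n Q" and n_least: "\<And>n'. \<exists>Q. flat n' Q \<Longrightarrow> n \<le> n'"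
      using ex_has_least_nat[of "\<lambda>n. \<exists>Q. flat n Q" E id] by auto
    then obtain Q where Q: "flat n Q" by blast
    have no_flat: "\<not> flat (n - 1) Q'" if "n \<noteq> 0" for Q'
    proof
      assume "flat (n - 1) Q'"
      then have "n \<le> n - 1" by (intro n_least) blast
      then show False using that by simp
    qed
    have "n = 0"
    proof (rule ccontr)
      assume n: "n \<noteq> 0"
      obtain x where x: "x \<in> supp Q" "\<not> snd x \<le> n - 1"
        using Q no_flat[OF n, of Q] unfolding flat_def by blast
      moreover have "snd x \<le> n" using x Q by (simp add: flat_def)
      ultimately have x: "x \<in> supp Q" "snd x = n" by auto
      have "(Suc (fst x), n - 1) \<in> supp (lower Q)"
      proof -
        have "\<not> p dvd int n"
          using x n by (intro small) (auto simp: supp_def I_def simplex_def)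
        moreover have "lower Q (Suc (fst x), n - 1) = of_int (int n) * Q x"
        proof -
          have "Q (fst x, Suc (n - 1)) = Q x" using n x(2) by (cases x) simp
          then show ?thesis using n by (simp add: lower_def)
        qed
        moreover have "\<not> null_mod (Q x)" and xI: "x \<in> I" using x(1) by (auto simp: supp_def)
        ultimately have "\<not> null_mod (lower Q (Suc (fst x), n - 1))"
          using null_mod_const_mult[of "int n" "Q x"] by simp
        moreover have "(Suc (fst x), n - 1) \<in> I"
          using xI n x(2) by (auto simp: I_def simplex_def)
        ultimately show ?thesis by (simp add: supp_def)
      qed
      moreover have "snd y \<le> n - 1" if y: "y \<in> supp (lower Q)" for y
      proof (rule ccontr)
        assume "\<not> snd y \<le> n - 1"
        then have "Suc (snd y) > n" by simp
        moreover have "fst y \<noteq> 0" using y by (auto simp: supp_def lower_def split: prod.splits if_splits)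
        moreover have "(fst y - 1, Suc (snd y)) \<in> I"
          using y \<open>fst y \<noteq> 0\<close> by (auto simp: supp_def I_def simplex_def)
        ultimately have "null_mod (Q (fst y - 1, Suc (snd y)))"
          using Q by (force simp: flat_def supp_def)
        then have "null_mod (lower Q y)" by (auto simp: lower_def split: prod.split)
        then show False using y by (simp add: supp_def)
      qed
      ultimately have "flat (n - 1) (lower Q)"
        using Q lower_W by (auto simp: flat_def)
      then show False
        using no_flat[OF n] by blast
    qed
    then show ?thesis using Q by blast
  qed
  then obtain Q where Q: "flat 0 Q" and least: "\<And>Q'. flat 0 Q' \<Longrightarrow> card (supp Q) \<le> card (supp Q')"
    using ex_has_least_nat[of "flat 0" _ "\<lambda>Q. card (supp Q)"] by blast
  obtain x0 where x0: "x0 \<in> supp Q" using Q by (auto simp: flat_def)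
  define n where "n = fst x0"
  have x0n: "x0 = (n, 0)" using x0 Q by (auto simp: flat_def n_def prod_eq_iff)
  have single: "x = x0" if x: "x \<in> supp Q" for x
  proof (rule ccontr)
    assume ne: "x \<noteq> x0"
    have sx: "snd x = 0" using x Q by (auto simp: flat_def)
    \<comment> \<open>\<open>Y^n\<close> has weight \<open>- n\<close>, so this form has smaller support and still contains \<open>x\<close>.\<close>
    define Q' where "Q' = (\<lambda>y. weight Q y + of_int (int n) * Q y)"
    have Q'W: "Q' \<in> W"
      using weight_W[of Q] Q unfolding W_iff Q'_def pairing_add pairing_mult flat_def by (auto intro: dvd_add dvd_mult)
    have Q'y: "Q' y = of_int (int (snd y) - int (fst y) + int n) * Q y" for y
      by (simp add: Q'_def weight_alt algebra_simps)
    have sub: "supp Q' \<subseteq> supp Q - {x0}"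
      using x0n by (auto simp: supp_def Q'y simp del: of_int_add of_int_diff)
    have "x \<in> supp Q'"
    proof -
      have "\<not> p dvd int (snd x) - int (fst x) + int n"
        using ne x x0 sx unfolding x0n
        by (intro small) (auto simp: supp_def I_def simplex_def prod_eq_iff)
      then show ?thesis
        using x null_mod_const_mult[of _ "Q x"] by (simp add: supp_def Q'y del: of_int_add of_int_diff)
    qed
    then have "flat 0 Q'" using Q Q'W sub by (auto simp: flat_def)
    from least[OF this] have "card (supp Q) \<le> card (supp Q - {x0})"
      using sub fin card_mono[of "supp Q - {x0}" "supp Q'"] by (force simp: supp_def)
    moreover have "card (supp Q - {x0}) < card (supp Q)"
      using x0 fin by (intro card_Diff1_less) (auto simp: supp_def)
    ultimately show False by simp
  qed
  define u :: form where "u x = (if x = x0 then 1 else 0)" for x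
  have x0I: "x0 \<in> I" using x0 by (simp add: supp_def)
  have pair_u: "pairing E xi u = xi x0" for xi
  proof -
    have "pairing E xi u = (\<Sum>x\<in>I. if x = x0 then xi x else 0)"
      unfolding pairing_def u_def I_def[symmetric] by (rule sum.cong) auto
    then show ?thesis using x0I fin by simp
  qed
  have uW: "u \<in> W"
    unfolding W_iff pair_u
  proof
    fix xi assume "xi \<in> C"
    then have "null_mod (pairing E xi Q)" using Q by (simp add: flat_def W_iff)
    moreover have "pairing E xi Q = xi x0 * Q x0 + (\<Sum>x\<in>I-{x0}. xi x * Q x)"
      unfolding pairing_def I_def[symmetric] using fin x0I by (rule sum.remove)
    moreover have "null_mod (\<Sum>x\<in>I-{x0}. xi x * Q x)"
      using single by (intro dvd_sum dvd_mult) (auto simp: supp_def)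
    ultimately have "null_mod (xi x0 * Q x0)" by (simp add: dvd_add_left_iff)
    then show "null_mod (xi x0)" using x0 by (simp add: null_mod_mult_iff supp_def)
  qed
  have du: "degree (u x) \<le> d" for x by (simp add: u_def)
  obtain a b where ab: "\<not> null_mod a" "degree a \<le> m * d" "\<forall>x\<in>I. null_mod (a * u x + (\<Sum>l<m. b l * v l x))"
    using certificate[of u d] uW du unfolding W_iff by blast
  have "null_mod (eval_form E (\<lambda>x. a * u x + (\<Sum>l<m. b l * v l x)))"
    unfolding eval_form_def by (rule null_mod_pairing) (use ab in \<open>auto simp: I_def\<close>)
  then have "null_below L (a * eval_form E u + (\<Sum>l<m. b l * eval_form E (v l)))"
    unfolding eval_form_def pairing_add pairing_sum pairing_mult by (rule null_mod_imp_null_below)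
  moreover have "null_below L (\<Sum>l<m. b l * eval_form E (v l))"
    by (intro null_below_sum null_below_mult ev)
  ultimately have "null_below L (a * eval_form E u + (\<Sum>l<m. b l * eval_form E (v l)) - (\<Sum>l<m. b l * eval_form E (v l)))"
    by (rule null_below_diff)
  then have "null_below L (F ^ n * a)"
    by (simp add: eval_form_def pair_u x0n mult.commute)
  moreover have "\<not> p dvd coeff (F ^ n) 0"
    using F_unit p_gt_1 by (induction n) (auto simp: coeff_mult p_dvd_mult_iff)
  ultimately have "null_below L a" by (rule null_below_cancel_unit[rotated])
  moreover have "degree a < L"
  proof -
    have "m * d \<le> X" using mq by (simp add: X_def d_def)
    then have "degree a \<le> X" using ab(2) by (rule order_trans[rotated])
    also have "X < L" by (rule le_less_trans[OF _ size']) simp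
    finally show ?thesis .
  qed
  ultimately show False using null_below_imp_null_mod ab(1) by blast
qed

end

section \<open>Counting zeros with multiplicity\<close>

context prime_modulus
begin

lemma null_mod_root_factor:
  assumes "p dvd poly a t"
  obtains b where "null_mod (a - [:- t, 1:] * b)"
proof -
  have "a = [:- t, 1:] * synthetic_div a t + [:poly a t:]"
    using synthetic_div_correct'[of t a] by simp
  then have "a - [:- t, 1:] * synthetic_div a t = [:poly a t:]"
    by (metis add_diff_cancel_left')
  moreover have "null_mod [:poly a t:]" using assms by simp
  ultimately show ?thesis using that[of "synthetic_div a t"] by metis
qed

lemma not_null_mod_linear: "\<not> null_mod [:- t, 1:]"
proof
  assume "null_mod [:- t, 1:]"
  then have "p dvd coeff [:- t, 1:] (Suc 0)" unfolding null_mod_iff by blast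
  then show False using p_gt_1 by simp
qed

text \<open>Away from \<open>t = 0\<close>, and for orders below \<open>p\<close>, the derivatives \<open>\<theta>^m\<close> detect multiplicities. If \<open>a\<close> and
\<open>\<theta> a\<close> are both divisible by the \<open>M\<close>-th power of a linear factor, then the product rule shows that the
cofactor of \<open>a\<close> vanishes at the root, because \<open>M\<close> and the root are units.\<close>

lemma theta_vanishing_multiplicity:
  assumes "\<not> p dvd t" "int M \<le> p" "\<And>m. m < M \<Longrightarrow> p dvd poly ((theta ^^ m) a) t"
  shows "\<exists>b. null_mod (a - [:- t, 1:] ^ M * b)"
  using assms(2,3)
proof (induction M arbitrary: a)
  case 0
  then show ?case by (intro exI[of _ a]) simp
next
  case (Suc M)
  define l where "l = [:- t, 1:]"
  obtain b where b: "null_mod (a - l ^ M * b)"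
    using Suc.IH[of a] Suc.prems by (auto simp: l_def)
  have "p dvd poly b t"
  proof (cases M)
    case 0
    have "p dvd poly (a - l ^ M * b) t" using b by (rule null_mod_poly)
    then show ?thesis using 0 Suc.prems(2)[of 0] by (simp add: dvd_diff_right_iff)
  next
    case (Suc M')
    have "p dvd poly ((theta ^^ m) (theta a)) t" if "m < M" for m
      using Suc.prems(2)[of "Suc m"] that by (simp add: funpow_swap1)
    then obtain c where c: "null_mod (theta a - l ^ M * c)"
      using Suc.IH[of "theta a"] Suc.prems(1) by (auto simp: l_def)
    have tl: "theta l = tvar" by (simp add: l_def theta_def pderiv_pCons)
    have "theta (l ^ M) = of_nat M * l ^ M' * tvar"
      using theta_power[of l M] by (simp only: tl Suc diff_Suc_1)
    then have e: "theta (l ^ M * b) = l ^ M' * (of_nat M * tvar * b + l * theta b)"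
      unfolding theta_mult by (simp add: Suc algebra_simps)
    have "l ^ M' * (of_nat M * tvar * b + l * (theta b - c)) =
        (theta a - l ^ M * c) - theta (a - l ^ M * b)"
      unfolding theta_diff e unfolding Suc power_Suc by algebra
    then have "null_mod (l ^ M' * (of_nat M * tvar * b + l * (theta b - c)))"
      using c b by (simp only: dvd_diff null_mod_theta)
    then have "null_mod (of_nat M * tvar * b + l * (theta b - c))"
      using not_null_mod_linear[of t, folded l_def] by (simp only: null_mod_mult_iff null_mod_power_iff) blast
    then have "p dvd poly (of_nat M * tvar * b + l * (theta b - c)) t"
      by (rule null_mod_poly)
    then have "p dvd int M * t * poly b t" by (simp add: l_def mult_ac)
    moreover have "\<not> p dvd int M"
      using Suc Suc.prems(1) by (auto dest: zdvd_imp_le)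
    ultimately show ?thesis using assms(1) by (simp add: p_dvd_mult_iff)
  qed
  then obtain c where c: "null_mod (b - l * c)" unfolding l_def by (rule null_mod_root_factor)
  have "a - l ^ Suc M * c = (a - l ^ M * b) + l ^ M * (b - l * c)"
    by (simp add: algebra_simps)
  then have "null_mod (a - l ^ Suc M * c)" using b c by (simp only: dvd_add dvd_mult)
  then show ?case unfolding l_def by blast
qed

lemma roots_times_multiplicity_le_degree:
  assumes fin: "finite T" and inj: "\<And>s t. s \<in> T \<Longrightarrow> t \<in> T \<Longrightarrow> p dvd s - t \<Longrightarrow> s = t"
    and T0: "\<And>t. t \<in> T \<Longrightarrow> \<not> p dvd t" and M: "int M \<le> p"
    and van: "\<And>t m. t \<in> T \<Longrightarrow> m < M \<Longrightarrow> p dvd poly ((theta ^^ m) a) t"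
    and nz: "\<not> null_mod a"
  shows "card T * M \<le> degree a"
proof -
  define g where "g S = (\<Prod>t\<in>S. [:- t, 1:] ^ M)" for S :: "int set"
  have "\<exists>b. null_mod (a - g S * b)" if "S \<subseteq> T" for S
    using finite_subset[OF that fin] that
  proof (induction S rule: finite_induct)
    case empty
    show ?case by (intro exI[of _ a]) (simp add: g_def)
  next
    case (insert s S)
    let ?l = "[:- s, 1:]"
    obtain b where b: "null_mod (a - g S * b)" using insert by auto
    obtain c where c: "null_mod (a - ?l ^ M * c)"
      using theta_vanishing_multiplicity[of s M a] T0 M van insert.prems by blast
    have gs: "\<not> p dvd poly (g S) s"
    proof
      assume "p dvd poly (g S) s"
      then have "p dvd (\<Prod>t\<in>S. (s - t) ^ M)"
        by (simp add: g_def poly_prod poly_power)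
      then obtain t where t: "t \<in> S" "p dvd (s - t) ^ M"
        using prime_p insert.hyps(1) by (auto simp: prime_dvd_prod_iff)
      then have "p dvd s - t" using prime_p prime_dvd_power by blast
      then show False using inj[of s t] t insert by auto
    qed
    have "\<exists>d. null_mod (b - ?l ^ j * d)" if "j \<le> M" for j
      using that
    proof (induction j)
      case 0
      show ?case by (intro exI[of _ b]) simp
    next
      case (Suc j)
      then obtain d where d: "null_mod (b - ?l ^ j * d)" by auto
      have lM: "?l ^ M = ?l ^ j * ?l * ?l ^ (M - Suc j)"
        using Suc.prems by (metis le_add_diff_inverse power_Suc2 power_add)
      have "?l ^ j * (g S * d - ?l * (?l ^ (M - Suc j) * c)) =
          (a - ?l ^ M * c) - (a - g S * b) - g S * (b - ?l ^ j * d)"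
        unfolding lM by algebra
      then have "null_mod (?l ^ j * (g S * d - ?l * (?l ^ (M - Suc j) * c)))"
        using b c d by (simp only: dvd_diff dvd_mult)
      then have "null_mod (g S * d - ?l * (?l ^ (M - Suc j) * c))"
        using not_null_mod_linear by (simp only: null_mod_mult_iff null_mod_power_iff) blast
      then have "p dvd poly (g S * d - ?l * (?l ^ (M - Suc j) * c)) s" by (rule null_mod_poly)
      then have "p dvd poly (g S) s * poly d s" by simp
      then have "p dvd poly d s" using gs by (simp add: p_dvd_mult_iff)
      then obtain e where e: "null_mod (d - ?l * e)" by (rule null_mod_root_factor)
      have "b - ?l ^ Suc j * e = (b - ?l ^ j * d) + ?l ^ j * (d - ?l * e)"
        unfolding power_Suc by algebra
      then have "null_mod (b - ?l ^ Suc j * e)" using d e by (simp only: dvd_add dvd_mult)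
      then show ?case by blast
    qed
    then obtain d where d: "null_mod (b - ?l ^ M * d)" by blast
    have "a - g (insert s S) * d = (a - g S * b) + g S * (b - ?l ^ M * d)"
      using insert.hyps by (simp add: g_def algebra_simps)
    then have "null_mod (a - g (insert s S) * d)" using b d by (simp only: dvd_add dvd_mult)
    then show ?case by blast
  qed
  then obtain b where b: "null_mod (a - g T * b)" by blast
  obtain c where c: "null_mod (b - c)" "c \<noteq> 0 \<Longrightarrow> \<not> p dvd lead_coeff c"
    using ex_reduced[of b] by blast
  have gc: "null_mod (a - g T * c)"
  proof -
    have "a - g T * c = (a - g T * b) + g T * (b - c)" by (simp add: algebra_simps)
    then show ?thesis using b c by (simp only: dvd_add dvd_mult)
  qed
  have c0: "c \<noteq> 0" using gc nz by auto
  have lead: "lead_coeff (g T) = 1"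
    unfolding g_def lead_coeff_prod lead_coeff_power by simp
  have g0: "[:- t, 1:] ^ M \<noteq> (0 :: int poly)" for t by simp
  have dg: "degree (g T) = card T * M"
    unfolding g_def by (subst degree_prod_eq_sum_degree) (auto simp: degree_power_eq)
  have "coeff (g T * c) (degree (g T) + degree c) = lead_coeff c"
    unfolding coeff_mult_degree_sum lead by simp
  moreover have "p dvd coeff a n - coeff (g T * c) n" for n
    using gc by (simp add: null_mod_iff)
  ultimately have "\<not> p dvd coeff a (degree (g T) + degree c)"
    using c(2)[OF c0] by (metis dvd_diff_right_iff)
  then have "degree (g T) + degree c \<le> degree a"
    by (intro le_degree) auto
  then show ?thesis using dg by simp
qed

end

section \<open>The truncated Bessel function\<close>

text \<open>The truncated Bessel function in the variable \<open>t = (x / 2)\<^sup>2\<close>, multiplied by \<open>(N!)\<^sup>2\<close> to make its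
coefficients integers.\<close>

definition bessel_poly :: "nat \<Rightarrow> int poly" where
  "bessel_poly N = (\<Sum>n\<le>N. monom ((-1) ^ n * (int (fact N div fact n))\<^sup>2) n)"

lemma coeff_bessel_poly:
  "coeff (bessel_poly N) n = (if n \<le> N then (-1) ^ n * (int (fact N div fact n))\<^sup>2 else 0)"
  by (simp add: bessel_poly_def coeff_sum)

lemma degree_bessel_poly: "degree (bessel_poly N) \<le> N"
  by (rule degree_le) (simp add: coeff_bessel_poly)

lemma theta_theta_bessel_poly:
  "theta (theta (bessel_poly N)) = monom ((-1) ^ N) (Suc N) - tvar * bessel_poly N"
proof (rule poly_eqI)
  fix n
  show "coeff (theta (theta (bessel_poly N))) n = coeff (monom ((-1) ^ N) (Suc N) - tvar * bessel_poly N) n"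
  proof (cases n)
    case 0
    then show ?thesis by (simp add: coeff_theta)
  next
    case (Suc m)
    have "fact N div fact m = Suc m * (fact N div fact (Suc m) :: nat)" if le: "Suc m \<le> N"
    proof -
      obtain k where k: "fact N = fact (Suc m) * (k :: nat)"
        using fact_dvd[OF le] by (rule dvdE)
      then have "(fact N :: nat) = fact m * (Suc m * k)" by (simp add: algebra_simps)
      then have "(fact N :: nat) div fact m = Suc m * k" by simp
      moreover have "fact N div fact (Suc m) = k" unfolding k by simp
      ultimately show ?thesis by simp
    qed
    then have "int (fact N div fact m) = int (Suc m) * int (fact N div fact (Suc m))" if "Suc m \<le> N"
      using that by (simp only: of_nat_mult)
    then show ?thesis
      unfolding Suc by (auto simp: coeff_theta coeff_bessel_poly coeff_tvar_mult power_mult_distrib power2_eq_square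
          simp del: mult_pCons_left of_nat_Suc fact_Suc)
  qed
qed

lemma card_simplex: "2 * card (simplex E) = (E + 1) * (E + 2)"
proof (induction E)
  case 0
  have "simplex 0 = {(0, 0)}" by (auto simp: simplex_def)
  then show ?case by simp
next
  case (Suc E)
  have eq: "simplex (Suc E) = simplex E \<union> (\<lambda>j. (j, Suc E - j)) ` {..Suc E}"
    by (force simp: simplex_def image_iff)
  have "card ((\<lambda>j. (j, Suc E - j)) ` {..Suc E}) = Suc (Suc E)"
    by (subst card_image) (auto simp: inj_on_def)
  moreover have "simplex E \<inter> (\<lambda>j. (j, Suc E - j)) ` {..Suc E} = {}"
    by (auto simp: simplex_def)
  ultimately have "card (simplex (Suc E)) = card (simplex E) + Suc (Suc E)"
    unfolding eq by (subst card_Un_disjoint) auto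
  then show ?case using Suc by (simp add: algebra_simps)
qed

lemma theta_tvar_power: "theta (tvar ^ a) = of_nat a * tvar ^ a"
  unfolding theta_power theta_tvar by (cases a) (simp_all add: algebra_simps)

lemma theta_funpow_sum: "(theta ^^ m) (sum f S) = (\<Sum>x\<in>S. (theta ^^ m) (f x))"
  by (induction m) (auto simp: theta_sum)

lemma theta_funpow_of_int_mult: "(theta ^^ m) (of_int c * a) = of_int c * (theta ^^ m) a"
  by (induction m) (auto simp: theta_mult)

lemma poly_diff_dvd: "(a - b :: int) dvd poly f a - poly f b"
proof (induction f)
  case (pCons c f)
  have "poly (pCons c f) a - poly (pCons c f) b = (a - b) * poly f a + b * (poly f a - poly f b)"
    by (simp add: algebra_simps)
  then show ?case using pCons.IH by (metis dvd_add dvd_mult dvd_triv_left)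
qed simp

locale odd_prime =
  fixes p :: nat
  assumes prime_nat: "prime p" and ge_3: "p \<ge> 3"
begin

abbreviation N :: nat where "N \<equiv> (p + 1) div 2"
abbreviation F :: "int poly" where "F \<equiv> bessel_poly N"
abbreviation H :: "int poly" where "H \<equiv> theta F"
abbreviation w :: "int poly" where "w \<equiv> monom 1 (N - 1)"

lemma odd_p: "odd p"
  using prime_nat ge_3 prime_odd_nat by auto

lemma N_less: "N < p" and N_ge: "N \<ge> 2" and two_N: "2 * N = p + 1"
  using odd_p ge_3 by auto

sublocale bessel_mod "int p" F H "monom ((-1) ^ N) (Suc N)" "N - 1"
proof
  show "prime (int p)" using prime_nat by simp
  interpret prime_modulus "int p" by standard fact
  show "null_below (N - 1) (monom ((-1) ^ N) (Suc N))" by (auto simp: null_below_def)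
  have "\<not> int p dvd int (fact N)"
    using prime_nat N_less by (simp only: int_dvd_int_iff prime_dvd_fact_iff)
  then show "\<not> int p dvd coeff F 0"
    by (simp add: coeff_bessel_poly power2_eq_square p_dvd_mult_iff)
qed (use N_less theta_theta_bessel_poly ge_3 in auto)

definition bessel_mono :: "nat \<Rightarrow> nat \<Rightarrow> nat \<Rightarrow> nat \<Rightarrow> int poly" where
  "bessel_mono a j k l = tvar ^ a * F ^ j * H ^ k * w ^ l"

lemma theta_w_power: "theta (w ^ l) = of_nat (l * (N - 1)) * w ^ l"
proof -
  have w: "w ^ l = monom 1 ((N - 1) * l)" by (simp add: monom_power)
  show ?thesis
    unfolding w theta_monom by (simp add: of_nat_poly smult_monom mult.commute)
qed

lemma theta_bessel_mono:
  "theta (bessel_mono a j k l) = of_int (int a + int (l * (N - 1))) * bessel_mono a j k l + of_int (int j) * bessel_mono a (j - 1) (Suc k) l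
     + of_int (int k * (-1) ^ N) * bessel_mono (a + 2) j (k - 1) (Suc l) + of_int (- int k) * bessel_mono (Suc a) (Suc j) (k - 1) l"
proof -
  have "monom ((-1) ^ N) (Suc N) = [:(-1) ^ N:] * (tvar ^ 2 * w)"
  proof -
    have "tvar ^ 2 * w = monom 1 (2 + (N - 1))"
      by (simp add: mult_monom flip: monom_altdef[of "1 :: int" 2, simplified])
    also have "2 + (N - 1) = Suc N" using N_ge by simp
    finally show ?thesis by (simp add: smult_monom)
  qed
  then have H: "theta H = of_int ((-1) ^ N) * tvar ^ 2 * w - tvar * F"
    unfolding theta_theta_bessel_poly by (simp add: of_int_poly)
  show ?thesis
    unfolding bessel_mono_def theta_mult theta_tvar_power theta_w_power
      theta_power[of F] theta_power[of H] H power_add power_Suc of_int_add of_int_mult of_int_minus of_int_of_nat_eq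
    by algebra
qed

text \<open>Integer combinations of the products \<open>t^a F^j H^k w^l\<close> with \<open>a \<le> A\<close> and \<open>j + k \<le> E\<close>. The exponent \<open>l\<close> is left
free, since \<open>w\<close> takes the value \<open>1\<close> at the points of interest.\<close>

inductive_set bspan :: "nat \<Rightarrow> nat \<Rightarrow> int poly set" for A E where
  zero: "0 \<in> bspan A E"
| step: "u \<in> bspan A E \<Longrightarrow> a \<le> A \<Longrightarrow> j + k \<le> E \<Longrightarrow> u + of_int c * bessel_mono a j k l \<in> bspan A E"

lemma bspan_bessel_mono: "a \<le> A \<Longrightarrow> j + k \<le> E \<Longrightarrow> of_int c * bessel_mono a j k l \<in> bspan A E"
  using bspan.step[OF bspan.zero] by fastforce

lemma bspan_add: "v \<in> bspan A E \<Longrightarrow> u \<in> bspan A E \<Longrightarrow> u + v \<in> bspan A E"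
  by (induction rule: bspan.induct) (auto simp: add.assoc[symmetric] intro: bspan.intros)

lemma bspan_mono: "u \<in> bspan A E \<Longrightarrow> A \<le> A' \<Longrightarrow> u \<in> bspan A' E"
  by (induction rule: bspan.induct) (auto intro: bspan.intros)

lemma bspan_theta: "u \<in> bspan A E \<Longrightarrow> theta u \<in> bspan (A + 2) E"
proof (induction rule: bspan.induct)
  case zero
  show ?case by (simp add: bspan.zero)
next
  case (step u a j k c l)
  have 1: "of_int c' * bessel_mono a (j - 1) (Suc k) l \<in> bspan (A + 2) E" if "j = 0 \<longrightarrow> c' = 0" for c'
    using that step.hyps by (cases "j = 0") (auto intro: bspan.zero bspan_bessel_mono)
  have 2: "of_int c' * bessel_mono (a + 2) j (k - 1) (Suc l) \<in> bspan (A + 2) E" for c'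
    using step.hyps by (auto intro!: bspan_bessel_mono)
  have 3: "of_int c' * bessel_mono (Suc a) (Suc j) (k - 1) l \<in> bspan (A + 2) E" if "k = 0 \<longrightarrow> c' = 0" for c'
    using that step.hyps by (cases "k = 0") (auto intro: bspan.zero bspan_bessel_mono)
  have "theta (u + of_int c * bessel_mono a j k l) = theta u + (of_int (c * (int a + int (l * (N - 1)))) * bessel_mono a j k l
     + of_int (c * int j) * bessel_mono a (j - 1) (Suc k) l
     + of_int (c * (int k * (-1) ^ N)) * bessel_mono (a + 2) j (k - 1) (Suc l)
     + of_int (c * (- int k)) * bessel_mono (Suc a) (Suc j) (k - 1) l)"
    unfolding theta_add theta_mult theta_of_int theta_bessel_mono of_int_mult[of c] by algebra
  also have "\<dots> \<in> bspan (A + 2) E"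
    using step by (intro bspan_add 1 2 3 bspan_bessel_mono) auto
  finally show ?case .
qed

lemma bspan_theta_funpow: "u \<in> bspan A E \<Longrightarrow> (theta ^^ m) u \<in> bspan (A + 2 * m) E"
proof (induction m)
  case (Suc m)
  then show ?case using bspan_theta[of "(theta ^^ m) u"] by (simp add: add.commute add.left_commute)
qed simp

definition bessel_root :: "int \<Rightarrow> bool" where
  "bessel_root t \<longleftrightarrow> int p dvd poly F t \<and> int p dvd t ^ (N - 1) - 1"

lemma poly_bessel_mono: "poly (bessel_mono a j k l) t = t ^ a * poly F t ^ j * poly H t ^ k * (t ^ (N - 1)) ^ l"
  by (simp add: bessel_mono_def poly_monom poly_power)

text \<open>Where \<open>F = 0\<close> and \<open>w = 1\<close>, only \<open>t\<close> and \<open>H\<close> survive. The coefficients \<open>R\<close> do not depend on the point,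
so their vanishing can be imposed once for all points.\<close>

lemma bspan_at_root:
  assumes "u \<in> bspan A E"
  shows "\<exists>R. \<forall>t. bessel_root t \<longrightarrow> int p dvd poly u t - (\<Sum>(a, b)\<in>{..A} \<times> {..E}. R a b * (t ^ a * poly H t ^ b))"
  using assms
proof (induction rule: bspan.induct)
  case zero
  show ?case by (intro exI[of _ "\<lambda>_ _. 0"]) simp
next
  case (step u a j k c l)
  from step.IH obtain R where
    R: "\<And>t. bessel_root t \<Longrightarrow> int p dvd poly u t - (\<Sum>(a, b)\<in>{..A} \<times> {..E}. R a b * (t ^ a * poly H t ^ b))"
    by blast
  define R' where "R' a' b = R a' b + (if (a', b) = (a, k) then if j = 0 then c else 0 else 0)" for a' b
  show ?case
  proof (intro exI[of _ R'] allI impI)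
    fix t assume t: "bessel_root t"
    have ak: "(a, k) \<in> {..A} \<times> {..E}" using step.hyps by auto
    have "(\<Sum>(a', b)\<in>{..A} \<times> {..E}. R' a' b * (t ^ a' * poly H t ^ b)) =
        (\<Sum>(a', b)\<in>{..A} \<times> {..E}. R a' b * (t ^ a' * poly H t ^ b)) +
        (\<Sum>x\<in>{..A} \<times> {..E}. if x = (a, k) then (if j = 0 then c else 0) * (t ^ a * poly H t ^ k) else 0)"
      unfolding sum.distrib[symmetric] by (intro sum.cong) (auto simp: R'_def algebra_simps split: if_splits)
    also have "(\<Sum>x\<in>{..A} \<times> {..E}. if x = (a, k) then (if j = 0 then c else 0) * (t ^ a * poly H t ^ k) else 0)
        = (if j = 0 then c else 0) * (t ^ a * poly H t ^ k)"
      using ak by (subst sum.delta) auto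
    finally have sum: "(\<Sum>(a', b)\<in>{..A} \<times> {..E}. R' a' b * (t ^ a' * poly H t ^ b)) =
        (\<Sum>(a', b)\<in>{..A} \<times> {..E}. R a' b * (t ^ a' * poly H t ^ b)) +
        (if j = 0 then c else 0) * (t ^ a * poly H t ^ k)" .
    have "int p dvd c * poly (bessel_mono a j k l) t - (if j = 0 then c else 0) * (t ^ a * poly H t ^ k)"
    proof (cases "j = 0")
      case True
      have "(t ^ (N - 1)) mod int p = 1 mod int p"
        using t by (simp add: bessel_root_def mod_eq_dvd_iff)
      then have "((t ^ (N - 1)) ^ l) mod int p = 1 mod int p"
        by (metis power_mod power_one)
      then have "int p dvd (t ^ (N - 1)) ^ l - 1" by (simp add: mod_eq_dvd_iff)
      then have "int p dvd c * t ^ a * poly H t ^ k * ((t ^ (N - 1)) ^ l - 1)" by (rule dvd_mult)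
      then show ?thesis using True by (simp add: poly_bessel_mono algebra_simps)
    next
      case False
      then have "int p dvd poly F t ^ j"
        using t by (auto simp: bessel_root_def intro: dvd_power_le[of _ _ 1 j, simplified])
      then show ?thesis using False by (simp add: poly_bessel_mono)
    qed
    from dvd_add[OF R[OF t] this]
    show "int p dvd poly (u + of_int c * bessel_mono a j k l) t
        - (\<Sum>(a, b)\<in>{..A} \<times> {..E}. R' a b * (t ^ a * poly H t ^ b))"
      unfolding sum by (simp add: of_int_poly algebra_simps)
  qed
qed

text \<open>The auxiliary polynomial is \<open>phi\<close>, with \<open>4 r\<^sup>2 (2 r + 1) (r + 1)\<^sup>2\<close> coefficients and
\<open>4 r\<^sup>4 (2 r + 1)\<close> conditions. If it were zero modulo \<open>p\<close>, its lowest coefficient with respect to \<open>w\<close>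
would contradict \<open>zero_estimate\<close>. The hypothesis \<open>500 * r ^ 4 \<le> p\<close> comes from there: the degrees in the zero
estimate are of order \<open>r ^ 4\<close> and must stay below \<open>N - 1\<close>.\<close>

theorem stepanov_bound:
  assumes r: "r \<ge> 1" and size: "500 * r ^ 4 \<le> p"
    and T: "T \<subseteq> {1..<int p}" "\<And>t. t \<in> T \<Longrightarrow> bessel_root t"
  shows "card T * r\<^sup>2 \<le> 2 * r\<^sup>2 + 2 * r * N + (2 * r + 1) * (N - 1)"
proof -
  define E A D M where "E = 2 * r" and "A = 2 * r\<^sup>2" and "D = 2 * r + 2" and "M = r\<^sup>2"
  define U where "U = {..<A} \<times> simplex E \<times> {..<D}"
  define Eq where "Eq = {..<M} \<times> ({..A + 2 * M - 1} \<times> {..E})"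
  define bas where "bas u = (case u of (i, (j, k), l) \<Rightarrow> bessel_mono i j k l)" for u
  have q: "card (simplex E) = (2 * r + 1) * (r + 1)"
    using card_simplex[of E] by (simp add: E_def algebra_simps)
  have r2: "1 \<le> r\<^sup>2" using r by simp
  have fin: "finite U" "finite Eq" by (auto simp: U_def Eq_def)
  have card: "card Eq < card U"
  proof -
    have "card {..A + 2 * M - 1} = 4 * r\<^sup>2" using r2 by (simp add: A_def M_def)
    then have "card Eq = (4 * (r\<^sup>2 * r\<^sup>2)) * (2 * r + 1)"
      by (simp only: Eq_def card_cartesian_product) (simp add: M_def E_def power2_eq_square power4_eq_xxxx algebra_simps)
    also have "\<dots> < (4 * (r\<^sup>2 * (r + 1)\<^sup>2)) * (2 * r + 1)"
      using r by (intro mult_strict_right_mono mult_strict_left_mono power_strict_mono) auto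
    also have "\<dots> = card U"
      by (simp add: U_def card_cartesian_product q A_def D_def power2_eq_square algebra_simps)
    finally show ?thesis .
  qed
  have bas: "(theta ^^ m) (bas u) \<in> bspan (A + 2 * M - 1) E" if "u \<in> U" "m < M" for m u
  proof -
    obtain i j k l where u: "u = (i, (j, k), l)" by (metis prod.exhaust)
    have "of_int 1 * bessel_mono i j k l \<in> bspan (A - 1) E"
      using that(1) by (intro bspan_bessel_mono) (auto simp: u U_def simplex_def)
    then have "bas u \<in> bspan (A - 1) E" by (simp add: bas_def u)
    then have "(theta ^^ m) (bas u) \<in> bspan (A - 1 + 2 * m) E" by (rule bspan_theta_funpow)
    then show ?thesis by (rule bspan_mono) (use that(2) r2 A_def in auto)
  qed
  define Phi where "Phi m u R \<longleftrightarrow> (\<forall>t. bessel_root t \<longrightarrow>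
      int p dvd poly ((theta ^^ m) (bas u)) t - (\<Sum>(a, b)\<in>{..A + 2 * M - 1} \<times> {..E}. R a b * (t ^ a * poly H t ^ b)))"
    for m u and R :: "nat \<Rightarrow> nat \<Rightarrow> int"
  define Rr where "Rr m u = (SOME R. Phi m u R)" for m u
  have Rr: "Phi m u (Rr m u)" if "u \<in> U" "m < M" for m u
  proof -
    have "\<exists>R. Phi m u R" using bspan_at_root[OF bas[OF that]] unfolding Phi_def .
    then show ?thesis unfolding Rr_def by (rule someI_ex)
  qed
  obtain x where x: "\<exists>u\<in>U. \<not> int p dvd x u"
    "\<And>e. e \<in> Eq \<Longrightarrow> int p dvd (\<Sum>u\<in>U. (case e of (m, a, b) \<Rightarrow> Rr m u a b) * x u)"
    using pigeonhole_mod[OF fin card, of "\<lambda>e u. case e of (m, a, b) \<Rightarrow> Rr m u a b"] by blast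
  define phi where "phi = (\<Sum>u\<in>U. of_int (x u) * bas u)"
  have van: "int p dvd poly ((theta ^^ m) phi) t" if t: "t \<in> T" and m: "m < M" for t m
  proof -
    define S where "S u = (\<Sum>(a, b)\<in>{..A + 2 * M - 1} \<times> {..E}. Rr m u a b * (t ^ a * poly H t ^ b))" for u
    have "poly ((theta ^^ m) phi) t = (\<Sum>u\<in>U. x u * poly ((theta ^^ m) (bas u)) t)"
      unfolding phi_def theta_funpow_sum theta_funpow_of_int_mult poly_sum by simp
    also have "\<dots> = (\<Sum>u\<in>U. x u * (poly ((theta ^^ m) (bas u)) t - S u)) + (\<Sum>u\<in>U. x u * S u)"
      by (simp add: sum.distrib[symmetric] algebra_simps)
    also have "(\<Sum>u\<in>U. x u * S u) =
        (\<Sum>ab\<in>{..A + 2 * M - 1} \<times> {..E}. \<Sum>u\<in>U. x u * (case ab of (a, b) \<Rightarrow> Rr m u a b * (t ^ a * poly H t ^ b)))"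
      unfolding S_def sum_distrib_left by (rule sum.swap)
    also have "\<dots> = (\<Sum>(a, b)\<in>{..A + 2 * M - 1} \<times> {..E}. (t ^ a * poly H t ^ b) * (\<Sum>u\<in>U. Rr m u a b * x u))"
      by (intro sum.cong) (auto simp: sum_distrib_left sum_distrib_right mult_ac)
    finally have eq: "poly ((theta ^^ m) phi) t = (\<Sum>u\<in>U. x u * (poly ((theta ^^ m) (bas u)) t - S u)) +
        (\<Sum>(a, b)\<in>{..A + 2 * M - 1} \<times> {..E}. (t ^ a * poly H t ^ b) * (\<Sum>u\<in>U. Rr m u a b * x u))" .
    have "int p dvd poly ((theta ^^ m) (bas u)) t - S u" if "u \<in> U" for u
      using Rr[OF that m] T(2)[OF t] by (simp add: Phi_def S_def)
    moreover have "int p dvd (\<Sum>u\<in>U. Rr m u a b * x u)" if "(a, b) \<in> {..A + 2 * M - 1} \<times> {..E}" for a b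
      using x(2)[of "(m, a, b)"] that m by (simp add: Eq_def)
    ultimately show ?thesis
      unfolding eq by (intro dvd_add dvd_sum) (auto intro!: dvd_mult)
  qed
  have nz: "\<not> null_mod phi"
  proof
    assume phi0: "null_mod phi"
    define P where "P l = (\<lambda>jk. \<Sum>i<A. monom (x (i, jk, l)) i)" for l
    have cP: "coeff (P l jk) i = (if i < A then x (i, jk, l) else 0)" for l jk i
      by (simp add: P_def coeff_sum)
    have "phi = (\<Sum>(i, jk, l)\<in>U. of_int (x (i, jk, l)) * bas (i, jk, l))"
      by (simp add: phi_def case_prod_unfold)
    also have "\<dots> = (\<Sum>i<A. \<Sum>jk\<in>simplex E. \<Sum>l<D. of_int (x (i, jk, l)) * bas (i, jk, l))"
      unfolding U_def sum.cartesian_product[symmetric] ..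
    also have "\<dots> = (\<Sum>i<A. \<Sum>l<D. \<Sum>jk\<in>simplex E. of_int (x (i, jk, l)) * bas (i, jk, l))"
      by (intro sum.cong sum.swap refl)
    also have "\<dots> = (\<Sum>l<D. \<Sum>i<A. \<Sum>jk\<in>simplex E. of_int (x (i, jk, l)) * bas (i, jk, l))"
      by (rule sum.swap)
    also have "\<dots> = (\<Sum>l<D. \<Sum>jk\<in>simplex E. \<Sum>i<A. of_int (x (i, jk, l)) * bas (i, jk, l))"
      by (intro sum.cong sum.swap refl)
    also have "\<dots> = (\<Sum>l<D. w ^ l * eval_form E (P l))"
    proof (intro sum.cong refl)
      fix l
      have "(\<Sum>i<A. of_int (x (i, jk, l)) * bas (i, jk, l)) =
          w ^ l * ((case jk of (j, k) \<Rightarrow> F ^ j * H ^ k) * P l jk)" for jk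
      proof -
        obtain j k where jk: "jk = (j, k)" by (cases jk)
        have "of_int (x (i, jk, l)) * bas (i, jk, l) = w ^ l * (F ^ j * H ^ k) * monom (x (i, jk, l)) i" for i
          by (simp add: bas_def jk bessel_mono_def monom_altdef of_int_poly mult_ac)
        then show ?thesis by (simp add: P_def jk sum_distrib_left mult.assoc)
      qed
      then show "(\<Sum>jk\<in>simplex E. \<Sum>i<A. of_int (x (i, jk, l)) * bas (i, jk, l)) = w ^ l * eval_form E (P l)"
        unfolding eval_form_def pairing_def sum_distrib_left by (intro sum.cong refl)
    qed
    finally have phi: "phi = (\<Sum>l<D. w ^ l * eval_form E (P l))" .
    \<comment> \<open>The powers of \<open>w\<close> that occur with a coefficient that is nonzero modulo \<open>p\<close>.\<close>
    define bad where "bad l \<longleftrightarrow> l < D \<and> (\<exists>jk\<in>simplex E. \<not> null_mod (P l jk))" for l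
    obtain i jk l where "i < A" "jk \<in> simplex E" "l < D" "\<not> int p dvd x (i, jk, l)"
      using x(1) by (auto simp: U_def)
    then have "bad l" unfolding bad_def null_mod_iff using cP[of l jk i] by metis
    define l0 where "l0 = (LEAST l. bad l)"
    have l0: "bad l0" unfolding l0_def by (rule LeastI) fact
    have below: "null_mod (w ^ l * eval_form E (P l))" if "l < l0" for l
    proof -
      have "\<not> bad l" using that not_less_Least unfolding l0_def by blast
      then have "null_mod (P l jk)" if "jk \<in> simplex E" for jk
        using that \<open>l < l0\<close> l0 by (auto simp: bad_def)
      then show ?thesis unfolding eval_form_def by (intro dvd_mult null_mod_pairing)
    qed
    have "{..<D} = {..<l0} \<union> {l0} \<union> {l0<..<D}" using l0 by (auto simp: bad_def)
    then have "phi = (\<Sum>l\<in>{..<l0} \<union> {l0} \<union> {l0<..<D}. w ^ l * eval_form E (P l))"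
      using phi by simp
    also have "\<dots> = (\<Sum>l<l0. w ^ l * eval_form E (P l)) + w ^ l0 * eval_form E (P l0)
        + (\<Sum>l\<in>{l0<..<D}. w ^ l * eval_form E (P l))"
      by (subst sum.union_disjoint; (subst sum.union_disjoint)?) auto
    also have "(\<Sum>l\<in>{l0<..<D}. w ^ l * eval_form E (P l)) =
        (\<Sum>l\<in>{l0<..<D}. w ^ l0 * (w * (w ^ (l - Suc l0) * eval_form E (P l))))"
    proof (intro sum.cong refl)
      fix l assume "l \<in> {l0<..<D}"
      then have "w ^ l = w ^ l0 * (w * w ^ (l - Suc l0))"
        by (simp flip: power_Suc power_add add: Suc_diff_Suc)
      then show "w ^ l * eval_form E (P l) = w ^ l0 * (w * (w ^ (l - Suc l0) * eval_form E (P l)))"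
        by (simp only: mult.assoc)
    qed
    also have "\<dots> = w ^ l0 * (w * (\<Sum>l\<in>{l0<..<D}. w ^ (l - Suc l0) * eval_form E (P l)))"
      unfolding sum_distrib_left ..
    finally have "phi - (\<Sum>l<l0. w ^ l * eval_form E (P l)) =
        w ^ l0 * (eval_form E (P l0) + w * (\<Sum>l\<in>{l0<..<D}. w ^ (l - Suc l0) * eval_form E (P l)))"
      by (simp add: algebra_simps)
    moreover have "null_mod (phi - (\<Sum>l<l0. w ^ l * eval_form E (P l)))"
      using phi0 below by (intro dvd_diff dvd_sum) auto
    moreover have "\<not> null_mod w"
    proof
      assume "null_mod w"
      then have "int p dvd coeff w (N - 1)" unfolding null_mod_iff by blast
      then show False using p_gt_1 by simp
    qed
    ultimately have "null_mod (eval_form E (P l0) + w * (\<Sum>l\<in>{l0<..<D}. w ^ (l - Suc l0) * eval_form E (P l)))"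
      (is "null_mod (_ + w * ?rest)") by (simp add: null_mod_mult_iff null_mod_power_iff)
    then have "null_below (N - 1) (eval_form E (P l0) + w * ?rest)" by (rule null_mod_imp_null_below)
    moreover have "null_below (N - 1) (w * ?rest)"
      by (rule null_below_mult') (simp add: null_below_def)
    ultimately have "null_below (N - 1) (eval_form E (P l0) + w * ?rest - w * ?rest)" by (rule null_below_diff)
    then have "null_below (N - 1) (eval_form E (P l0))" by simp
    moreover have "\<not> null_below (N - 1) (eval_form E (P l0))"
    proof (rule zero_estimate)
      have r4: "r \<le> r ^ 4" "r\<^sup>2 \<le> r ^ 4" "1 \<le> r ^ 4"
        using r power_increasing[of 1 4 r] power_increasing[of 2 4 r] by auto
      show "int E < int p"
      proof -
        have "2 * r < p" using size r4 by linarith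
        then show ?thesis by (simp add: E_def)
      qed
      show "degree (P l0 jk) \<le> A" for jk
        by (rule degree_le) (simp add: cP)
      show "\<exists>jk\<in>simplex E. \<not> null_mod (P l0 jk)" using l0 by (simp add: bad_def)
      show "card (simplex E) = card (simplex E)" ..
      have "card (simplex E) \<le> 6 * r\<^sup>2"
      proof -
        have "(2 * r + 1) * (r + 1) \<le> (3 * r) * (2 * r)" using r by (intro mult_mono) auto
        then show ?thesis unfolding q by (simp add: power2_eq_square)
      qed
      then have "A + card (simplex E) \<le> 8 * r\<^sup>2"
        "card (simplex E) * (A + card (simplex E)) \<le> (6 * r\<^sup>2) * (2 * r\<^sup>2 + 6 * r\<^sup>2)"
        unfolding A_def by (linarith, intro mult_mono add_mono) simp_all
      moreover have "(6 * r\<^sup>2) * (2 * r\<^sup>2 + 6 * r\<^sup>2) = 48 * r ^ 4"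
        by (simp add: power2_eq_square power4_eq_xxxx)
      moreover define c where "c = card (simplex E) * (A + card (simplex E))"
      ultimately have "A + card (simplex E) \<le> 8 * r\<^sup>2" "c \<le> 48 * r ^ 4" by simp_all
      then have "4 * (c + A + card (simplex E)) + 3 \<le> 227 * r ^ 4"
        using r4 by simp
      also have "227 * r ^ 4 < N - 1" using size r4 two_N by linarith
      finally show "4 * (card (simplex E) * (A + card (simplex E)) + A + card (simplex E)) + 3 < N - 1"
        by (simp only: c_def)
    qed
    ultimately show False by simp
  qed
  have "card T * M \<le> degree phi"
  proof (rule roots_times_multiplicity_le_degree)
    show "finite T" using T(1) by (rule finite_subset) simp
    show "s = t" if st: "s \<in> T" "t \<in> T" "int p dvd s - t" for s t
    proof -
      have "s \<in> {1..<int p}" "t \<in> {1..<int p}" using st T(1) by auto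
      then show ?thesis using st(3) by (metis atLeastLessThan_iff mod_eq_dvd_iff mod_pos_pos_trivial zero_le_one order_trans)
    qed
    show "\<not> int p dvd t" if "t \<in> T" for t
      using that T(1) zdvd_not_zless[of t "int p"] by fastforce
    have "r\<^sup>2 \<le> r ^ 4" using r by (intro power_increasing) auto
    then have "M \<le> p" unfolding M_def using size by linarith
    then show "int M \<le> int p" by simp
  qed (use van nz in auto)
  also have "degree phi \<le> A + E * N + (2 * r + 1) * (N - 1)"
    unfolding phi_def
  proof (rule degree_sum_le)
    fix u assume u: "u \<in> U"
    obtain i j k l where u': "u = (i, (j, k), l)" by (metis prod.exhaust)
    have "degree (F ^ j) \<le> N * j" "degree (H ^ k) \<le> N * k"
      using degree_bessel_poly[of N] degree_theta[of F]
      by (auto intro!: order_trans[OF degree_power_le] mult_right_mono)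
    moreover have "degree (tvar ^ i) \<le> i" using degree_power_le[of tvar i] by simp
    moreover have "degree (w ^ l) \<le> (N - 1) * l"
      using degree_power_le[of w l] by (simp add: degree_monom_eq)
    ultimately have "degree (bessel_mono i j k l) \<le> i + N * j + N * k + (N - 1) * l"
      unfolding bessel_mono_def
      using degree_mult_le[of "tvar ^ i" "F ^ j"] degree_mult_le[of "tvar ^ i * F ^ j" "H ^ k"]
        degree_mult_le[of "tvar ^ i * F ^ j * H ^ k" "w ^ l"] by linarith
    moreover have "N * j + N * k \<le> E * N"
    proof -
      have "(j + k) * N \<le> E * N" using u by (intro mult_right_mono) (auto simp: u' U_def simplex_def)
      then show ?thesis by (simp add: algebra_simps)
    qed
    moreover have "(N - 1) * l \<le> (2 * r + 1) * (N - 1)"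
      using u by (subst mult.commute, intro mult_right_mono) (auto simp: u' U_def D_def)
    moreover have "i \<le> A" using u by (auto simp: u' U_def)
    moreover have "degree (of_int (x u) * bas u) \<le> degree (bas u)"
      by (simp add: of_int_poly degree_smult_le)
    ultimately show "degree (of_int (x u) * bas u) \<le> A + E * N + (2 * r + 1) * (N - 1)"
      by (simp add: u' bas_def)
  qed (use fin in auto)
  finally show ?thesis by (simp add: A_def E_def M_def)
qed

lemma fermat_little:
  assumes "\<not> p dvd a"
  shows "int p dvd int a ^ (p - 1) - 1"
proof -
  have "int p dvd int a ^ p - int a" for a
  proof (induction a)
    case 0
    then show ?case using ge_3 by (simp add: power_0_left)
  next
    case (Suc a)
    have "{..p} = insert 0 (insert p {0<..<p})" using ge_3 by auto
    then have "(int a + 1) ^ p = int a ^ p + 1 + (\<Sum>k\<in>{0<..<p}. int (p choose k) * int a ^ k)"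
      using ge_3 unfolding binomial_ring by simp
    moreover have "int p dvd (\<Sum>k\<in>{0<..<p}. int (p choose k) * int a ^ k)"
      using prime_nat by (intro dvd_sum dvd_mult2) (auto simp: int_dvd_int_iff intro: dvd_choose_prime)
    moreover have "int (Suc a) ^ p - int (Suc a) = (int a ^ p - int a) + ((int a + 1) ^ p - int a ^ p - 1)"
      by (simp add: add.commute)
    ultimately show ?case using Suc by (simp only: dvd_add) simp
  qed
  from this[of a] have "int p dvd int a * (int a ^ (p - 1) - 1)"
    using ge_3 by (simp add: algebra_simps flip: power_Suc)
  then show ?thesis using assms by (simp add: p_dvd_mult_iff)
qed

text \<open>The inverse of \<open>2\<close> modulo \<open>p\<close> is \<open>N\<close>, so \<open>(x N)\<^sup>2\<close> represents \<open>(x / 2)\<^sup>2\<close>. The integer \<open>K\<close> is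
\<open>4^N (N!)\<^sup>2\<close> times the value at \<open>x\<close> of the truncated Bessel function, and it is congruent to \<open>4^N F((x N)\<^sup>2)\<close>. The
point is not \<open>0\<close>, since \<open>F\<close> does not vanish there.\<close>

lemma bessel_root_of_trunc_root:
  assumes x: "x \<in> {0..<int p}" and root: "rat_cong p (poly (bessel_J0_trunc p) (of_int x)) 0"
  shows "(x * int N)\<^sup>2 mod int p \<in> {1..<int p}" "bessel_root ((x * int N)\<^sup>2 mod int p)"
proof -
  define y where "y = (x * int N)\<^sup>2"
  define q where "q n = int (fact N div fact n)" for n
  define K where "K = (\<Sum>n\<le>N. (-1) ^ n * (q n)\<^sup>2 * (x\<^sup>2) ^ n * 4 ^ (N - n))"
  have q: "(of_int (q n) :: rat) * fact n = fact N" if "n \<le> N" for n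
  proof -
    have "(fact n :: nat) dvd fact N" using that by (rule fact_dvd)
    then have "fact N div fact n * fact n = (fact N :: nat)" by (rule dvd_div_mult_self)
    then have "q n * fact n = int (fact N)"
      unfolding q_def by (metis of_nat_fact of_nat_mult)
    then show ?thesis by (metis of_int_fact of_int_mult of_int_of_nat_eq of_nat_fact)
  qed
  have K: "(of_int K :: rat) = 4 ^ N * (fact N)\<^sup>2 * poly (bessel_J0_trunc p) (of_int x)"
  proof -
    have "(-1) ^ n * (of_int (q n))\<^sup>2 * ((of_int x)\<^sup>2) ^ n * 4 ^ (N - n) =
        4 ^ N * (fact N)\<^sup>2 * ((- 1) ^ n / (fact n)\<^sup>2 * (of_int x / 2 :: rat) ^ (2 * n))" if "n \<le> N" for n
    proof -
      have "(4 :: rat) ^ N = 4 ^ (N - n) * 4 ^ n" using that by (simp flip: power_add)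
      moreover have "(of_int x / 2 :: rat) ^ (2 * n) * 4 ^ n = ((of_int x)\<^sup>2) ^ n"
        by (subst power_mult, subst power_mult_distrib[symmetric]) (simp add: power_divide)
      moreover have "(fact N :: rat)\<^sup>2 / (fact n)\<^sup>2 = (of_int (q n))\<^sup>2"
        unfolding q[OF that, symmetric] by (simp add: power_mult_distrib)
      ultimately show ?thesis by (simp add: field_simps)
    qed
    then show ?thesis
      unfolding K_def bessel_J0_trunc_def poly_sum sum_distrib_left of_int_sum
      by (intro sum.cong) (auto simp: poly_power atLeast0AtMost)
  qed
  have "int p dvd K"
  proof -
    obtain c where c: "p_integral p c" "poly (bessel_J0_trunc p) (of_int x) = of_nat p * c"
      using root by (auto simp: rat_cong_def)
    obtain a d where ad: "c * of_int d = of_int a" "coprime d (int p)" "d \<noteq> 0"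
      using c(1) by (rule p_integralE)
    have "(of_int (K * d) :: rat) = 4 ^ N * (fact N)\<^sup>2 * of_nat p * (c * of_int d)"
      by (simp add: K c(2))
    also have "\<dots> = of_int (4 ^ N * (fact N)\<^sup>2 * int p * a)"
      by (simp add: ad(1))
    finally have "K * d = 4 ^ N * (fact N)\<^sup>2 * int p * a"
      by (simp only: of_int_eq_iff)
    then have "int p dvd K * d" by simp
    then show ?thesis using ad(2) by (metis coprime_commute coprime_dvd_mult_left_iff)
  qed
  moreover have "int p dvd 4 ^ N * poly F y - K"
  proof -
    have "poly F y = (\<Sum>n\<le>N. (-1) ^ n * (q n)\<^sup>2 * y ^ n)"
      by (simp add: bessel_poly_def q_def poly_sum poly_monom)
    then have "4 ^ N * poly F y - K = (\<Sum>n\<le>N. 4 ^ N * ((-1) ^ n * (q n)\<^sup>2 * y ^ n)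
        - (-1) ^ n * (q n)\<^sup>2 * (x\<^sup>2) ^ n * 4 ^ (N - n))"
      unfolding K_def by (simp only: sum_distrib_left sum_subtractf)
    also have "\<dots> = (\<Sum>n\<le>N. (-1) ^ n * (q n)\<^sup>2 * 4 ^ (N - n) * ((4 * y) ^ n - (x\<^sup>2) ^ n))"
    proof (intro sum.cong refl)
      fix n assume "n \<in> {..N}"
      then have "(4 :: int) ^ N = 4 ^ (N - n) * 4 ^ n" by (simp flip: power_add)
      then show "4 ^ N * ((-1) ^ n * (q n)\<^sup>2 * y ^ n) - (-1) ^ n * (q n)\<^sup>2 * (x\<^sup>2) ^ n * 4 ^ (N - n)
          = (-1) ^ n * (q n)\<^sup>2 * 4 ^ (N - n) * ((4 * y) ^ n - (x\<^sup>2) ^ n)"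
        by (simp add: power_mult_distrib algebra_simps)
    qed
    also have "int p dvd \<dots>"
    proof (intro dvd_sum dvd_mult)
      fix n
      have "2 * int N = int p + 1" using two_N by (metis of_nat_1 of_nat_add of_nat_mult of_nat_numeral)
      then have "4 * y = x\<^sup>2 * (int p + 1)\<^sup>2" by (simp add: y_def power_mult_distrib flip: \<open>2 * int N = int p + 1\<close>)
      then have "4 * y - x\<^sup>2 = int p * (x\<^sup>2 * (int p + 2))" by (simp add: power2_eq_square algebra_simps)
      then have "int p dvd 4 * y - x\<^sup>2" by simp
      also have "4 * y - x\<^sup>2 dvd (4 * y) ^ n - (x\<^sup>2) ^ n"
        using poly_diff_dvd[of "4 * y" "x\<^sup>2" "monom 1 n"] by (simp add: poly_monom)
      finally show "int p dvd (4 * y) ^ n - (x\<^sup>2) ^ n" .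
    qed
    finally show ?thesis .
  qed
  ultimately have "int p dvd 4 ^ N * poly F y" by (metis dvd_diff_left_iff)
  moreover have "\<not> int p dvd 4 ^ N"
  proof
    assume "int p dvd 4 ^ N"
    then have "int p dvd 4" using prime_p prime_dvd_power by blast
    then have "int p dvd 2 * 2" by simp
    then show False using not_dvd_2 by (simp only: p_dvd_mult_iff) simp
  qed
  ultimately have Fy: "int p dvd poly F y" by (simp add: p_dvd_mult_iff)
  have y_mod: "int p dvd y - y mod int p" by (metis dvd_minus_mod)
  have "\<not> int p dvd y"
  proof
    assume "int p dvd y"
    also have "y dvd poly F y - poly F 0" using poly_diff_dvd[of y 0 F] by simp
    finally have "int p dvd poly F 0" using Fy dvd_diff_right_iff by blast
    then show False using F_unit by (simp add: poly_0_coeff_0)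
  qed
  moreover have "y mod int p \<noteq> 0" using calculation by auto
  moreover have "0 \<le> y mod int p" "y mod int p < int p" using p_gt_1 by auto
  ultimately show "(x * int N)\<^sup>2 mod int p \<in> {1..<int p}"
    unfolding y_def by auto
  have "int p dvd y ^ (N - 1) - 1"
  proof -
    define z where "z = nat x * N"
    have z: "x * int N = int z" using x by (simp add: z_def)
    have "\<not> p dvd z"
    proof
      assume "p dvd z"
      then have "int p dvd int z * int z" by simp
      then show False using \<open>\<not> int p dvd y\<close> unfolding y_def z power2_eq_square by blast
    qed
    moreover have "2 * (N - 1) = p - 1" using two_N by linarith
    then have "y ^ (N - 1) = int z ^ (p - 1)"
      unfolding y_def z power_mult[symmetric] by (rule arg_cong)
    ultimately show ?thesis using fermat_little by simp
  qed
  moreover have "y - y mod int p dvd y ^ (N - 1) - (y mod int p) ^ (N - 1)"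
    using poly_diff_dvd[of y "y mod int p" "monom 1 (N - 1)"] by (simp add: poly_monom)
  then have "int p dvd y ^ (N - 1) - (y mod int p) ^ (N - 1)" using y_mod dvd_trans by blast
  ultimately have "int p dvd (y mod int p) ^ (N - 1) - 1"
    using dvd_diff[of "int p" "y ^ (N - 1) - 1" "y ^ (N - 1) - (y mod int p) ^ (N - 1)"] by simp
  moreover have "int p dvd poly F y - poly F (y mod int p)"
    using poly_diff_dvd[of y "y mod int p" F] y_mod dvd_trans by blast
  then have "int p dvd poly F (y mod int p)" using Fy dvd_diff_right_iff by blast
  ultimately show "bessel_root ((x * int N)\<^sup>2 mod int p)"
    unfolding y_def[symmetric] bessel_root_def by blast
qed

lemma square_fibre_card:
  assumes "X \<subseteq> {0..<int p}"
  shows "card X \<le> 2 * card ((\<lambda>x. (x * int N)\<^sup>2 mod int p) ` X)"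
proof -
  define g where "g x = (x * int N)\<^sup>2 mod int p" for x
  have fin: "finite X" using assms finite_subset by blast
  have fibre: "card {x \<in> X. g x = t} \<le> 2" for t
  proof (cases "{x \<in> X. g x = t} = {}")
    case False
    then obtain x0 where x0: "x0 \<in> X" "g x0 = t" by auto
    have "{x \<in> X. g x = t} \<subseteq> {x0, int p - x0}"
    proof
      fix x assume "x \<in> {x \<in> X. g x = t}"
      then have x: "x \<in> X" "g x = g x0" using x0 by auto
      have "int p dvd (x * int N)\<^sup>2 - (x0 * int N)\<^sup>2"
        using x(2) by (simp add: g_def mod_eq_dvd_iff)
      also have "(x * int N)\<^sup>2 - (x0 * int N)\<^sup>2 = int N * int N * ((x - x0) * (x + x0))"
        by (simp add: power2_eq_square algebra_simps)
      finally have "int p dvd int N \<or> int p dvd x - x0 \<or> int p dvd x + x0"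
        by (simp only: p_dvd_mult_iff) blast
      moreover have "\<not> int p dvd int N" using N_less N_ge by (auto dest: zdvd_imp_le)
      moreover have "0 \<le> x" "x < int p" "0 \<le> x0" "x0 < int p" using x x0 assms by auto
      moreover have "x = x0" if "int p dvd x - x0"
        using that calculation(3-6) by (metis mod_eq_dvd_iff mod_pos_pos_trivial)
      moreover have "x = x0 \<or> x = int p - x0" if sum: "int p dvd x + x0"
      proof -
        obtain k where k: "x + x0 = int p * k" using sum by (rule dvdE)
        have "k < 2"
        proof (rule ccontr)
          assume "\<not> k < 2"
          then have "int p * 2 \<le> int p * k" by (intro mult_left_mono) auto
          then show False using k calculation(3-6) by linarith
        qed
        moreover have "0 \<le> k"
        proof (rule ccontr)
          assume "\<not> 0 \<le> k"
          then have "int p * k < 0" using p_gt_1 by (simp add: mult_pos_neg)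
          then show False using k \<open>0 \<le> x\<close> \<open>0 \<le> x0\<close> by linarith
        qed
        ultimately have "k = 0 \<or> k = 1" by auto
        then show ?thesis using k \<open>0 \<le> x\<close> \<open>0 \<le> x0\<close> by auto
      qed
      ultimately show "x \<in> {x0, int p - x0}" by auto
    qed
    then have "card {x \<in> X. g x = t} \<le> card {x0, int p - x0}" by (intro card_mono) auto
    also have "\<dots> \<le> 2" by (simp add: card_insert_if)
    finally show ?thesis .
  next
    case True
    show ?thesis unfolding True by simp
  qed
  have "X = (\<Union>t\<in>g ` X. {x \<in> X. g x = t})" by auto
  then have "card X \<le> (\<Sum>t\<in>g ` X. card {x \<in> X. g x = t})"
    using card_UN_le[of "g ` X" "\<lambda>t. {x \<in> X. g x = t}"] fin by simp
  also have "\<dots> \<le> (\<Sum>t\<in>g ` X. 2)" by (intro sum_mono fibre)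
  finally show ?thesis by (simp add: g_def[abs_def])
qed

theorem num_roots_times_le:
  assumes r: "r \<ge> 1" and size: "500 * r ^ 4 \<le> p"
  shows "num_roots_mod p (bessel_J0_trunc p) * r \<le> 14 * p"
proof -
  define X where "X = {x \<in> {0..<int p}. rat_cong p (poly (bessel_J0_trunc p) (of_int x)) 0}"
  define T where "T = (\<lambda>x. (x * int N)\<^sup>2 mod int p) ` X"
  have "card X \<le> 2 * card T"
    unfolding T_def by (rule square_fibre_card) (auto simp: X_def)
  then have XT: "card X * r \<le> 2 * (card T * r)" by (metis mult.assoc mult_le_mono1)
  have "card T * r\<^sup>2 \<le> 2 * r\<^sup>2 + 2 * r * N + (2 * r + 1) * (N - 1)"
    by (rule stepanov_bound[OF r size]) (use bessel_root_of_trunc_root in \<open>auto simp: T_def X_def\<close>)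
  also have "\<dots> \<le> 2 * r\<^sup>2 + 2 * r * N + (3 * r) * N"
    using r by (intro add_left_mono mult_mono) auto
  finally have "(card T * r) * r \<le> (2 * r + 5 * N) * r"
    by (simp add: power2_eq_square algebra_simps)
  then have "card T * r \<le> 2 * r + 5 * N" using r by simp
  moreover have "r \<le> r ^ 4" using power_increasing[of 1 4 r] r by simp
  ultimately have "2 * (card T * r) \<le> 14 * p" using size N_less by linarith
  then show ?thesis using XT unfolding num_roots_mod_def X_def[symmetric] by linarith
qed

end

text \<open>For \<open>p > 500\<close> take \<open>r\<close> to be the integer part of \<open>(p / 500)^(1/4)\<close>; smaller primes are covered by the
constant.\<close>

theorem num_roots_three_quarters:
  assumes p: "prime p" "p \<ge> 3"
  shows "real (num_roots_mod p (bessel_J0_trunc p)) \<le> 500 * real p powr (3 / 4)"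
proof -
  interpret odd_prime p by standard (use p in auto)
  define n where "n = num_roots_mod p (bessel_J0_trunc p)"
  have n_le: "n \<le> p"
  proof -
    have "n \<le> card {0..<int p}" unfolding n_def num_roots_mod_def by (rule card_mono) auto
    then show ?thesis by simp
  qed
  have p1: "1 \<le> real p powr (3 / 4)" using p by (intro ge_one_powr_ge_zero) auto
  show ?thesis
  proof (cases "p \<le> 500")
    case True
    then have "real n \<le> 500" using n_le by simp
    then show ?thesis using p1 unfolding n_def by linarith
  next
    case False
    define z where "z = (real p / 500) powr (1 / 4)"
    have z1: "1 \<le> z" unfolding z_def using False by (intro ge_one_powr_ge_zero) auto
    define r where "r = nat \<lfloor>z\<rfloor>"
    have "1 \<le> \<lfloor>z\<rfloor>" using z1 by simp
    moreover from this have "real r = of_int \<lfloor>z\<rfloor>" by (simp add: r_def)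
    ultimately have r: "1 \<le> r" "real r \<le> z" "z \<le> 2 * real r"
      using floor_correct[of z] by linarith+
    have z4: "z ^ 4 = real p / 500"
      using p unfolding z_def by (simp add: powr_powr flip: powr_realpow)
    have "real r ^ 4 \<le> z ^ 4" using r by (intro power_mono) auto
    then have "real (500 * r ^ 4) \<le> real p" unfolding z4 by simp
    then have "500 * r ^ 4 \<le> p" by (simp only: of_nat_le_iff)
    then have "n * r \<le> 14 * p" unfolding n_def by (rule num_roots_times_le[OF r(1)])
    then have "real (n * r) \<le> real (14 * p)" by (simp only: of_nat_le_iff)
    then have nr: "real n * real r \<le> 14 * real p" by simp
    have "real n * z \<le> real n * (2 * real r)" using r by (intro mult_left_mono) auto
    then have nz: "real n * z \<le> 28 * real p" using nr by linarith
    have "real p powr (1 / 4) \<le> 5 * z"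
    proof -
      have "(500 :: real) powr (1 / 4) \<le> (5 ^ 4) powr (1 / 4)" by (intro powr_mono2) auto
      also have "\<dots> = 5" by (simp add: powr_powr flip: powr_realpow)
      finally have "(500 :: real) powr (1 / 4) * z \<le> 5 * z" using z1 by (intro mult_right_mono) auto
      moreover have "500 powr (1 / 4) * z = real p powr (1 / 4)"
        unfolding z_def by (simp flip: powr_mult)
      ultimately show ?thesis by simp
    qed
    then have "real n * real p powr (1 / 4) \<le> real n * (5 * z)" by (intro mult_left_mono) auto
    also have "\<dots> \<le> 140 * real p" using nz by (simp add: mult.commute)
    also have "\<dots> = (140 * real p powr (3 / 4)) * real p powr (1 / 4)"
      using p by (simp add: mult.assoc flip: powr_add)
    finally have "real n * real p powr (1 / 4) \<le> (140 * real p powr (3 / 4)) * real p powr (1 / 4)" .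
    moreover have "real p powr (1 / 4) > 0" using p by simp
    ultimately have "real n \<le> 140 * real p powr (3 / 4)" by (simp only: mult_le_cancel_right_pos)
    then show ?thesis using p1 unfolding n_def by linarith
  qed
qed

theorem theorem3:
  shows "\<exists>C::real. C > 0 \<and>
    (\<forall>p::nat. prime p \<and> p \<ge> 3 \<longrightarrow>
      real (num_roots_mod p (bessel_J0_trunc p)) \<le> C * real p powr (8 / 9))"
proof (intro exI[of _ 500] conjI allI impI)
  fix p :: nat assume p: "prime p \<and> p \<ge> 3"
  then have "real (num_roots_mod p (bessel_J0_trunc p)) \<le> 500 * real p powr (3 / 4)"
    by (intro num_roots_three_quarters) auto
  also have "\<dots> \<le> 500 * real p powr (8 / 9)"
    using p by (intro mult_left_mono powr_mono) auto
  finally show "real (num_roots_mod p (bessel_J0_trunc p)) \<le> 500 * real p powr (8 / 9)" .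
qed simp

end
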